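(* For every $k\ge 2$, $\ell\ge 1$ and every $\delta\in[0,1)$, $$\mathsf{PIC}_{\zeta_\ell,\delta}(\mathsf{Disj}_\ell)\ \ge\ (\ell-1)\cdot \mathsf{PIC}_{\zeta_2,\delta}(\mathsf{Disj}_2).$$
   Context: Coordinator model: $k$ processors and a coordinator; input a $k\times \ell$ Boolean matrix $X$, processor $i$ privately holds row $X^i$, the coordinator has no input, each processor has a private channel only to the coordinator, all parties have private coins. A protocol is $\delta$-error for $f$ if on every input it is correct with probability at least $1-\delta$. $\Pi^i(X)$ denotes processor $i$'s view of the transcript (the messages exchanged between processor $i$ and the coordinator). $\mathsf{Disj}_\ell(A)=1$ iff some column of the $k\times\ell$ Boolean matrix $A$ is all ones. Distribution $\zeta_\ell$ on $(\mathbf X,\mathbf M,\mathbf Z,\mathbf W)$, $\mathbf X\in\{0,1\}^{k\times\ell}$, $\mathbf M\in\{0,1\}^\ell$, $\mathbf Z\in[k]^\ell$, $\mathbf W\in[\ell]$: independently for each column $t$, $\Pr[\mathbf M_t=1]=1/3$, $\mathbf Z_t$ uniform in $[k]$; processor $\mathbf Z_t$'s entry in column $t$ is $0$, every other entry of column $t$ is $1$ if $\mathbf M_t=1$ and an independent uniform bit if $\mathbf M_t=0$; then $\mathbf W$ is uniform in $[\ell]$ and column $\mathbf W$ of $\mathbf X$ is overwritten by all ones. Partial information cost: $\mathbf M_{-\mathbf W}$ is $\mathbf M$ with coordinate $\mathbf W$ removed, $\mathbf X^i_{-\mathbf W}$ is row $\mathbf X^i$ with coordinate $\mathbf W$ removed,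 and $$\mathsf{PIC}_{\zeta_\ell}(\Pi)=\sum_{i=1}^k\Big(\mathbb I[\mathbf M_{-\mathbf W}:\Pi^i(\mathbf X)\mid \mathbf X^i,\mathbf Z,\mathbf W]+\mathbb I[\mathbf X^i_{-\mathbf W}:\Pi^i(\mathbf X)\mid \mathbf M,\mathbf Z,\mathbf W]\Big);$$ $\mathsf{PIC}_{\zeta_\ell,\delta}(\mathsf{Disj}_\ell)$ is the infimum of $\mathsf{PIC}_{\zeta_\ell}(\Pi)$ over $\delta$-error protocols $\Pi$ for $\mathsf{Disj}_\ell$. *)

theory Defs
  imports "HOL-Probability.Probability" "HOL-Probability.Product_PMF"
begin

text \<open>
  Processors are numbered \<open>0..<k\<close> and columns \<open>0..<l\<close>. A \<open>k \<times> l\<close> Boolean matrix is a function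
  \<open>X\<close> (row, then column) that is \<open>False\<close> outside the index range, so that every matrix has
  exactly one representation.
\<close>

type_synonym matrix = "nat \<Rightarrow> nat \<Rightarrow> bool"

definition matrices :: "nat \<Rightarrow> nat \<Rightarrow> matrix set" where
  "matrices k l = {X. \<forall>i t. X i t \<longrightarrow> i < k \<and> t < l}"

definition Disj :: "nat \<Rightarrow> nat \<Rightarrow> matrix \<Rightarrow> bool" where
  "Disj k l X \<longleftrightarrow> (\<exists>t<l. \<forall>i<k. X i t)"


section \<open>The coordinator model\<close>

text \<open>
  Communication is driven by the coordinator: as long as it has not halted, it picks a processor
  \<open>i\<close>, sends it a message, and receives a reply. A triple \<open>(i, m, m')\<close> in a history records that
  processor \<open>i\<close> was sent \<open>m\<close> and answered \<open>m'\<close>; either message may be empty.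
\<close>

type_synonym message = "bool list"
type_synonym history = "(nat \<times> message \<times> message) list"

datatype action = Send nat message | Halt bool

text \<open>
  Each party draws its private coins once, before the execution, from an arbitrary discrete
  distribution. As the communication is bounded (see \<open>is_protocol\<close> below), more general coin
  spaces would give no further protocols up to equality of the transcript distributions.
\<close>

record protocol =
  coord_coins :: "nat pmf"
  proc_coins :: "nat \<Rightarrow> nat pmf"
  coord_act :: "nat \<Rightarrow> history \<Rightarrow> action"
    \<comment> \<open>own coins, history so far\<close>
  proc_reply :: "nat \<Rightarrow> (nat \<Rightarrow> bool) \<Rightarrow> nat \<Rightarrow> (message \<times> message) list \<Rightarrow> message \<Rightarrow> message"
    \<comment> \<open>processor, its row, its coins, its view so far, the message just received\<close>
  max_rounds :: nat

definition view :: "nat \<Rightarrow> history \<Rightarrow> (message \<times> message) list" where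
  "view i h = map snd (filter (\<lambda>e. fst e = i) h)"

primrec history_upto :: "protocol \<Rightarrow> matrix \<Rightarrow> nat \<Rightarrow> (nat \<Rightarrow> nat) \<Rightarrow> nat \<Rightarrow> history" where
  "history_upto P X c r 0 = []"
| "history_upto P X c r (Suc n) =
    (let h = history_upto P X c r n in
     case coord_act P c h of
       Halt b \<Rightarrow> h
     | Send i m \<Rightarrow> h @ [(i, m, proc_reply P i (X i) (r i) (view i h) m)])"

definition transcript :: "protocol \<Rightarrow> matrix \<Rightarrow> nat \<Rightarrow> (nat \<Rightarrow> nat) \<Rightarrow> history" where
  "transcript P X c r = history_upto P X c r (max_rounds P)"

definition is_protocol :: "nat \<Rightarrow> nat \<Rightarrow> protocol \<Rightarrow> bool" where
  "is_protocol k l P \<longleftrightarrow>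
     (\<exists>B. \<forall>X \<in> matrices k l. \<forall>c \<in> set_pmf (coord_coins P).
        \<forall>r. (\<forall>i<k. r i \<in> set_pmf (proc_coins P i)) \<longrightarrow>
          (\<exists>b. coord_act P c (transcript P X c r) = Halt b) \<and>
          (\<forall>(i, m, m') \<in> set (transcript P X c r). i < k \<and> length m \<le> B \<and> length m' \<le> B))"

text \<open>Joint distribution of the full transcript and of the coordinator's final action on input \<open>X\<close>.\<close>

definition run :: "nat \<Rightarrow> protocol \<Rightarrow> matrix \<Rightarrow> (history \<times> action) pmf" where
  "run k P X =
     do { c \<leftarrow> coord_coins P;
          r \<leftarrow> Pi_pmf {..<k} 0 (proc_coins P);
          return_pmf (let h = transcript P X c r in (h, coord_act P c h)) }"

definition delta_error_protocols :: "real \<Rightarrow> nat \<Rightarrow> nat \<Rightarrow> (matrix \<Rightarrow> bool) \<Rightarrow> protocol set" where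
  "delta_error_protocols \<delta> k l f =
     {P. is_protocol k l P \<and>
         (\<forall>X \<in> matrices k l.
            measure_pmf.prob (run k P X) {(h, a). a = Halt (f X)} \<ge> 1 - \<delta>)}"


section \<open>The input distribution\<close>

definition zeta_column :: "nat \<Rightarrow> (bool \<times> nat \<times> (nat \<Rightarrow> bool)) pmf" where
  "zeta_column k =
     do { m \<leftarrow> bernoulli_pmf (1/3);
          z \<leftarrow> pmf_of_set {..<k};
          x \<leftarrow> Pi_pmf {..<k} False
                (\<lambda>i. if i = z then return_pmf False
                     else if m then return_pmf True
                     else bernoulli_pmf (1/2));
          return_pmf (m, z, x) }"

text \<open>Outside \<open>{..<l}\<close>, \<open>M\<close> and \<open>Z\<close> take the dummy values \<open>False\<close> and \<open>0\<close>.\<close>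

definition zeta :: "nat \<Rightarrow> nat \<Rightarrow> (matrix \<times> (nat \<Rightarrow> bool) \<times> (nat \<Rightarrow> nat) \<times> nat) pmf" where
  "zeta k l =
     do { C \<leftarrow> Pi_pmf {..<l} (False, 0, \<lambda>_. False) (\<lambda>_. zeta_column k);
          w \<leftarrow> pmf_of_set {..<l};
          return_pmf
            (\<lambda>i t. if t = w then i < k else snd (snd (C t)) i,
             \<lambda>t. fst (C t),
             \<lambda>t. fst (snd (C t)),
             w) }"


section \<open>Partial information cost\<close>

text \<open>
  Conditional mutual information (in bits) of discrete random variables on the probability space
  \<open>p\<close>. The space is cut down to the support of \<open>p\<close> because \<open>space (measure_pmf p)\<close> is the whole
  type, on which the random variables below would have uncountable range.
\<close>

definition cond_mutual_info :: "'a pmf \<Rightarrow> ('a \<Rightarrow> 'b) \<Rightarrow> ('a \<Rightarrow> 'c) \<Rightarrow> ('a \<Rightarrow> 'd) \<Rightarrow> real" where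
  "cond_mutual_info p A B C =
     prob_space.conditional_mutual_information (restrict_space (measure_pmf p) (set_pmf p)) 2
       (count_space (A ` set_pmf p)) (count_space (B ` set_pmf p)) (count_space (C ` set_pmf p))
       A B C"

definition drop_coord :: "nat \<Rightarrow> nat \<Rightarrow> (nat \<Rightarrow> 'a) \<Rightarrow> (nat \<Rightarrow> 'a)" where
  "drop_coord l w v = restrict v ({..<l} - {w})"

definition joint ::
  "nat \<Rightarrow> nat \<Rightarrow> protocol \<Rightarrow> (matrix \<times> (nat \<Rightarrow> bool) \<times> (nat \<Rightarrow> nat) \<times> nat \<times> history) pmf" where
  "joint k l P =
     do { (X, M, Z, W) \<leftarrow> zeta k l;
          (h, a) \<leftarrow> run k P X;
          return_pmf (X, M, Z, W, h) }"

definition PIC :: "nat \<Rightarrow> nat \<Rightarrow> protocol \<Rightarrow> real" where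
  "PIC k l P =
     (\<Sum>i<k.
        cond_mutual_info (joint k l P)
          (\<lambda>(X, M, Z, W, h). drop_coord l W M)
          (\<lambda>(X, M, Z, W, h). view i h)
          (\<lambda>(X, M, Z, W, h). (X i, Z, W))
      + cond_mutual_info (joint k l P)
          (\<lambda>(X, M, Z, W, h). drop_coord l W (X i))
          (\<lambda>(X, M, Z, W, h). view i h)
          (\<lambda>(X, M, Z, W, h). (M, Z, W)))"

definition PIC_inf :: "real \<Rightarrow> nat \<Rightarrow> nat \<Rightarrow> (matrix \<Rightarrow> bool) \<Rightarrow> ereal" where
  "PIC_inf \<delta> k l f = (INF P \<in> delta_error_protocols \<delta> k l f. ereal (PIC k l P))"

end

theory Submission
  imports Defs
begin

text \<open>
  Fix a protocol for \<open>l\<close> columns and an ordered pair \<open>s \<noteq> t\<close>. A protocol for two columns places its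
  input at columns \<open>s\<close> and \<open>t\<close> and fills in the other columns as in \<open>zeta_column\<close>. The coordinator
  samples them and tells processor \<open>i\<close> all \<open>Z\<^sub>j\<close>, the bits \<open>M\<^sub>j\<close> for \<open>j\<close> in a set \<open>A\<close>, and its own
  entries for \<open>j \<notin> A\<close>; the entries for \<open>j \<in> A\<close> each processor draws privately given \<open>M\<^sub>j\<close> and \<open>Z\<^sub>j\<close>.
  No sampled column is all ones, so the error is preserved. Given that \<open>s\<close> is the planted column, the
  cost of the new protocol is at most the sum over \<open>i\<close> of
  \<open>I[M\<^sub>t : \<Pi>\<^sup>i | M\<^sub>A, X\<^sup>i, Z] + I[X\<^sup>i\<^sub>t : \<Pi>\<^sup>i | X\<^sup>i\<^sub>B, M, Z]\<close>, where \<open>B\<close> is the complement of \<open>A \<union> {s, t}\<close>,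
  because the columns outside \<open>{s, t}\<close> are independent of those two. If \<open>A\<close> is the set of predecessors
  of \<open>t\<close> in some order of the columns other than \<open>s\<close>, these are the terms of the two chain rules for
  the cost of the given protocol. Choosing \<open>A\<close> as the cyclic interval strictly between \<open>s\<close> and \<open>t\<close>
  serves both planted columns at once: it precedes \<open>t\<close> in the cyclic order starting at \<open>s\<close>, and it
  precedes \<open>s\<close> in the reversed cyclic order starting at \<open>t\<close>. Summing over the \<open>l (l - 1)\<close> ordered pairs
  gives \<open>l\<close> times the cost of the given protocol.
\<close>

section \<open>Conditional mutual information via entropies\<close>

text \<open>Shannon entropy in bits, as the expected surprisal of the fibre of \<open>A\<close>
  through the sample point. In this form it depends only on the partition that \<open>A\<close>
  induces on the support, so values may be recoded freely.\<close>

definition ent :: "'a pmf \<Rightarrow> ('a \<Rightarrow> 'b) \<Rightarrow> real" where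
  "ent p A = measure_pmf.expectation p (\<lambda>x. - log 2 (measure_pmf.prob p {y. A y = A x}))"

definition cmi :: "'a pmf \<Rightarrow> ('a \<Rightarrow> 'b) \<Rightarrow> ('a \<Rightarrow> 'c) \<Rightarrow> ('a \<Rightarrow> 'd) \<Rightarrow> real" where
  "cmi p A B C = ent p (\<lambda>x. (A x, C x)) + ent p (\<lambda>x. (B x, C x))
     - ent p (\<lambda>x. (A x, B x, C x)) - ent p C"

lemma ent_map: "ent (map_pmf f p) A = ent p (\<lambda>x. A (f x))"
  by (simp add: ent_def vimage_def)

lemma cmi_map: "cmi (map_pmf f p) A B C = cmi p (\<lambda>x. A (f x)) (\<lambda>x. B (f x)) (\<lambda>x. C (f x))"
  by (simp add: cmi_def ent_map)

lemma ent_cong: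
  assumes "\<And>x y. x \<in> set_pmf p \<Longrightarrow> y \<in> set_pmf p \<Longrightarrow> A x = A y \<longleftrightarrow> B x = B y"
  shows "ent p A = ent p B"
  unfolding ent_def
proof (rule integral_cong_AE)
  show "AE x in measure_pmf p. - log 2 (measure_pmf.prob p {y. A y = A x}) = - log 2 (measure_pmf.prob p {y. B y = B x})"
  proof (rule AE_pmfI)
    fix x assume "x \<in> set_pmf p"
    then have "measure_pmf.prob p {y. A y = A x} = measure_pmf.prob p {y. B y = B x}"
      using assms by (intro measure_prob_cong_0) (auto simp: set_pmf_eq)
    then show "- log 2 (measure_pmf.prob p {y. A y = A x}) = - log 2 (measure_pmf.prob p {y. B y = B x})"
      by simp
  qed
qed auto

text \<open>\<open>A\<close> and \<open>B\<close> enter the four entropies only together with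
  \<open>C\<close>, so their fibres matter only inside a fibre of \<open>C\<close>.\<close>

lemma cmi_cong:
  assumes "\<And>x y. x \<in> set_pmf p \<Longrightarrow> y \<in> set_pmf p \<Longrightarrow> C x = C y \<longleftrightarrow> C' x = C' y"
    and "\<And>x y. x \<in> set_pmf p \<Longrightarrow> y \<in> set_pmf p \<Longrightarrow> C x = C y \<Longrightarrow> A x = A y \<longleftrightarrow> A' x = A' y"
    and "\<And>x y. x \<in> set_pmf p \<Longrightarrow> y \<in> set_pmf p \<Longrightarrow> C x = C y \<Longrightarrow> B x = B y \<longleftrightarrow> B' x = B' y"
  shows "cmi p A B C = cmi p A' B' C'"
proof -
  have "ent p (\<lambda>x. (A x, C x)) = ent p (\<lambda>x. (A' x, C' x))"
    "ent p (\<lambda>x. (B x, C x)) = ent p (\<lambda>x. (B' x, C' x))"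
    "ent p (\<lambda>x. (A x, B x, C x)) = ent p (\<lambda>x. (A' x, B' x, C' x))"
    "ent p C = ent p C'"
    using assms by (intro ent_cong; blast)+
  then show ?thesis
    by (simp add: cmi_def)
qed

text \<open>On a finite support every random variable is a simple function, so the explicit sum for
  conditional mutual information and its nonnegativity apply. Expanding the logarithm of the
  quotient gives the four entropies.\<close>

lemma cond_mutual_info_eq_cmi_and_nonneg:
  assumes fin: "finite (set_pmf p)"
  shows cond_mutual_info_eq_cmi: "cond_mutual_info p A B C = cmi p A B C"
    and cmi_nonneg: "0 \<le> cmi p A B C"
proof -
  let ?M = "restrict_space (measure_pmf p) (set_pmf p)"
  have space [simp]: "space ?M = set_pmf p"
    by (simp add: space_restrict_space)
  have sets: "sets ?M = Pow (set_pmf p)"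
    by (auto simp: sets_restrict_space)
  interpret M: prob_space ?M
  proof
    have "emeasure (measure_pmf p) (set_pmf p) = 1"
      using measure_pmf.emeasure_eq_1_AE[of "set_pmf p" p] by (auto intro: AE_pmfI)
    then show "emeasure ?M (space ?M) = 1"
      by (simp add: emeasure_restrict_space)
  qed
  interpret M: information_space ?M 2
    by unfold_locales simp
  have sf: "simple_function ?M F" for F :: "'a \<Rightarrow> 'e"
    unfolding simple_function_def using fin by (auto simp: sets)
  note sd = M.simple_distributedI[OF sf measure_nonneg refl]
  let ?pr = "\<lambda>F v. measure ?M (F -` {v} \<inter> space ?M)"
  let ?q = "\<lambda>F x. measure_pmf.prob p {y. F y = F x}"
  have pr_q: "measure ?M (F -` {F x} \<inter> space ?M) = ?q F x" for F :: "'a \<Rightarrow> 'e" and x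
  proof -
    have "measure ?M (F -` {F x} \<inter> space ?M) = measure_pmf.prob p (F -` {F x} \<inter> set_pmf p)"
      by (simp add: measure_restrict_space)
    also have "\<dots> = ?q F x"
      by (intro measure_prob_cong_0) (auto simp: set_pmf_eq)
    finally show ?thesis .
  qed
  have pos: "?q F x \<noteq> 0" if "x \<in> set_pmf p" for F :: "'a \<Rightarrow> 'e" and x
    using that by (simp add: measure_pmf_zero_iff) blast
  let ?T = "\<lambda>x. (A x, B x, C x)"
  let ?g = "\<lambda>(a, b, c). log 2 (?pr ?T (a, b, c) / (?pr (\<lambda>x. (A x, C x)) (a, c) * (?pr (\<lambda>x. (B x, C x)) (b, c) / ?pr C c)))"
  have "cond_mutual_info p A B C =
      (\<Sum>v\<in>?T ` set_pmf p. ?pr ?T v * ?g v)"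
    unfolding cond_mutual_info_def
    by (subst M.conditional_mutual_information_eq[OF sd sd sd sd, simplified space]) (auto intro!: sum.cong)
  \<comment> \<open>Each value of the triple is split into the sample points above it, which turns
    the sum over values into an expectation over the support.\<close>
  also have "\<dots> = (\<Sum>v\<in>?T ` set_pmf p. \<Sum>x\<in>{x\<in>set_pmf p. ?T x = v}. pmf p x * ?g (?T x))"
  proof (rule sum.cong[OF refl])
    fix v assume "v \<in> ?T ` set_pmf p"
    have "?pr ?T v = measure_pmf.prob p {x\<in>set_pmf p. ?T x = v}"
      by (auto simp: measure_restrict_space intro!: arg_cong[where f="measure_pmf.prob p"])
    also have "\<dots> = (\<Sum>x\<in>{x\<in>set_pmf p. ?T x = v}. pmf p x)"
      using fin by (intro measure_measure_pmf_finite) auto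
    finally have "?pr ?T v * ?g v = (\<Sum>x\<in>{x\<in>set_pmf p. ?T x = v}. pmf p x * ?g v)"
      by (simp add: sum_distrib_right)
    also have "\<dots> = (\<Sum>x\<in>{x\<in>set_pmf p. ?T x = v}. pmf p x * ?g (?T x))"
      by (intro sum.cong) auto
    finally show "?pr ?T v * ?g v = (\<Sum>x\<in>{x\<in>set_pmf p. ?T x = v}. pmf p x * ?g (?T x))" .
  qed
  also have "\<dots> = (\<Sum>x\<in>set_pmf p. pmf p x * ?g (?T x))"
    using fin by (intro sum.group) auto
  also have "\<dots> = (\<Sum>x\<in>set_pmf p. pmf p x * (- log 2 (?q (\<lambda>x. (A x, C x)) x))) + (\<Sum>x\<in>set_pmf p. pmf p x * (- log 2 (?q (\<lambda>x. (B x, C x)) x)))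
     - (\<Sum>x\<in>set_pmf p. pmf p x * (- log 2 (?q ?T x))) - (\<Sum>x\<in>set_pmf p. pmf p x * (- log 2 (?q C x)))"
    unfolding sum.distrib[symmetric] sum_subtractf[symmetric]
  proof (rule sum.cong[OF refl])
    fix x assume x: "x \<in> set_pmf p"
    have "?g (?T x) = log 2 (?q ?T x / (?q (\<lambda>x. (A x, C x)) x * (?q (\<lambda>x. (B x, C x)) x / ?q C x)))"
      using pr_q[of ?T x] pr_q[of "\<lambda>x. (A x, C x)" x] pr_q[of "\<lambda>x. (B x, C x)" x] pr_q[of C x] by simp
    also have "\<dots> = log 2 (?q ?T x) + log 2 (?q C x) - log 2 (?q (\<lambda>x. (A x, C x)) x) - log 2 (?q (\<lambda>x. (B x, C x)) x)"
      using pos[OF x, of ?T] pos[OF x, of "\<lambda>x. (A x, C x)"] pos[OF x, of "\<lambda>x. (B x, C x)"] pos[OF x, of C]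
      by (simp add: log_divide log_mult)
    finally have g: "?g (?T x) = log 2 (?q ?T x) + log 2 (?q C x) - log 2 (?q (\<lambda>x. (A x, C x)) x) - log 2 (?q (\<lambda>x. (B x, C x)) x)" .
    show "pmf p x * ?g (?T x) = pmf p x * (- log 2 (?q (\<lambda>x. (A x, C x)) x)) + pmf p x * (- log 2 (?q (\<lambda>x. (B x, C x)) x))
        - pmf p x * (- log 2 (?q ?T x)) - pmf p x * (- log 2 (?q C x))"
      unfolding g by algebra
  qed
  also have "\<dots> = cmi p A B C"
    unfolding cmi_def ent_def by (simp only: integral_measure_pmf[OF fin] real_scaleR_def)
  finally show eq: "cond_mutual_info p A B C = cmi p A B C" .
  show "0 \<le> cmi p A B C"
    using M.conditional_mutual_information_nonneg[OF sf[of A] sf[of B] sf[of C]]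
    unfolding eq[symmetric] cond_mutual_info_def by simp
qed

section \<open>Entropy under independence and under uniform mixtures\<close>

lemma ent_indep:
  assumes fin: "finite (set_pmf p)"
    and indep: "map_pmf (\<lambda>x. (A x, S x)) p = pair_pmf (map_pmf A p) (map_pmf S p)"
  shows "ent p (\<lambda>x. (A x, S x)) = ent p A + ent p S"
proof -
  have prob: "measure_pmf.prob p {y. (A y, S y) = (A x, S x)}
      = measure_pmf.prob p {y. A y = A x} * measure_pmf.prob p {y. S y = S x}" for x
  proof -
    have "measure_pmf.prob p {y. (A y, S y) = (A x, S x)} = pmf (map_pmf (\<lambda>x. (A x, S x)) p) (A x, S x)"
      by (simp add: pmf_map vimage_def)
    also have "\<dots> = pmf (map_pmf A p) (A x) * pmf (map_pmf S p) (S x)"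
      unfolding indep by (simp add: pmf_pair)
    finally show ?thesis
      by (simp add: pmf_map vimage_def)
  qed
  have pos: "measure_pmf.prob p {y. F y = F x} \<noteq> 0" if "x \<in> set_pmf p" for F :: "'a \<Rightarrow> 'e" and x
    using that by (simp add: measure_pmf_zero_iff) blast
  have "ent p (\<lambda>x. (A x, S x)) = measure_pmf.expectation p
     (\<lambda>x. - log 2 (measure_pmf.prob p {y. A y = A x}) + - log 2 (measure_pmf.prob p {y. S y = S x}))"
    unfolding ent_def prob
    by (intro integral_cong_AE AE_pmfI) (auto simp: log_mult pos)
  also have "\<dots> = ent p A + ent p S"
    unfolding ent_def by (intro Bochner_Integration.integral_add integrable_measure_pmf_finite fin)
  finally show ?thesis .
qed

text \<open>\<open>W\<close> identifies the component, so a fibre of \<open>(A, W)\<close> that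
  meets the support lies in one component and gets \<open>1 / l\<close> of its mass there. The term
  \<open>log 2 (real l)\<close> is the entropy of the uniform index.\<close>

lemma ent_mixture:
  assumes l: "l > 0" and fin: "\<And>w. w < l \<Longrightarrow> finite (set_pmf (q w))"
    and W: "\<And>w x. w < l \<Longrightarrow> x \<in> set_pmf (q w) \<Longrightarrow> W x = w"
  shows "ent (bind_pmf (pmf_of_set {..<l}) q) (\<lambda>x. (A x, W x))
    = log 2 (real l) + (\<Sum>w<l. ent (q w) A) / real l"
proof -
  let ?p = "bind_pmf (pmf_of_set {..<l}) q"
  have ne: "{..<l} \<noteq> {}" using l by auto
  have prob: "measure_pmf.prob ?p {y. (A y, W y) = (A x, W x)} = measure_pmf.prob (q w) {y. A y = A x} / real l"
    if w: "w < l" and x: "x \<in> set_pmf (q w)" for w x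
  proof -
    have "measure_pmf.prob ?p {y. (A y, W y) = (A x, W x)}
        = measure_pmf.expectation ?p (indicator {y. (A y, W y) = (A x, W x)})"
      by simp
    also have "\<dots> = (\<Sum>v<l. measure_pmf.prob (q v) {y. (A y, W y) = (A x, W x)}) / real l"
      using fin ne by (subst pmf_expectation_bind_pmf_of_set) (auto simp: divide_inverse sum_distrib_left mult.commute)
    also have "(\<Sum>v<l. measure_pmf.prob (q v) {y. (A y, W y) = (A x, W x)})
       = (\<Sum>v<l. if v = w then measure_pmf.prob (q w) {y. A y = A x} else 0)"
    proof (intro sum.cong refl)
      fix v assume v: "v \<in> {..<l}"
      show "measure_pmf.prob (q v) {y. (A y, W y) = (A x, W x)}
         = (if v = w then measure_pmf.prob (q w) {y. A y = A x} else 0)"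
      proof (cases "v = w")
        case True
        then show ?thesis using W[OF w] W[OF w x]
          by (auto intro!: measure_prob_cong_0 simp: set_pmf_eq)
      next
        case False
        then show ?thesis using W[of v] v W[OF w x]
          by (auto simp: measure_pmf_zero_iff)
      qed
    qed
    finally show ?thesis using w by (simp add: sum.delta)
  qed
  have pos: "measure_pmf.prob (q w) {y. A y = A x} \<noteq> 0" if "x \<in> set_pmf (q w)" for w x
    using that by (simp add: measure_pmf_zero_iff) blast
  have "ent ?p (\<lambda>x. (A x, W x))
     = (\<Sum>w<l. measure_pmf.expectation (q w) (\<lambda>x. - log 2 (measure_pmf.prob ?p {y. (A y, W y) = (A x, W x)}))) / real l"
    unfolding ent_def using fin ne by (subst pmf_expectation_bind_pmf_of_set) (auto simp: divide_inverse sum_distrib_left mult.commute)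
  also have "(\<Sum>w<l. measure_pmf.expectation (q w) (\<lambda>x. - log 2 (measure_pmf.prob ?p {y. (A y, W y) = (A x, W x)})))
     = (\<Sum>w<l. log 2 (real l) + ent (q w) A)"
  proof (intro sum.cong refl)
    fix w assume w: "w \<in> {..<l}"
    have "measure_pmf.expectation (q w) (\<lambda>x. - log 2 (measure_pmf.prob ?p {y. (A y, W y) = (A x, W x)}))
      = measure_pmf.expectation (q w) (\<lambda>x. log 2 (real l) + - log 2 (measure_pmf.prob (q w) {y. A y = A x}))"
      using w l by (intro integral_cong_AE AE_pmfI) (auto simp: prob[simplified] log_divide pos)
    also have "\<dots> = log 2 (real l) + ent (q w) A"
      unfolding ent_def using fin w
      by (subst Bochner_Integration.integral_add) (auto intro!: integrable_measure_pmf_finite)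
    finally show "measure_pmf.expectation (q w) (\<lambda>x. - log 2 (measure_pmf.prob ?p {y. (A y, W y) = (A x, W x)})) = log 2 (real l) + ent (q w) A" .
  qed
  finally show ?thesis
    using l by (simp add: sum.distrib field_simps)
qed

text \<open>Conditioning on \<open>W\<close> averages over the components: the terms
  \<open>log 2 (real l)\<close> occur twice with each sign and cancel. \<open>C'\<close> need only
  have the fibres of \<open>(C, W)\<close>, which leaves the shape of the conditioning tuple
  free.\<close>

lemma cmi_mixture:
  assumes l: "l > 0" and fin: "\<And>w. w < l \<Longrightarrow> finite (set_pmf (q w))"
    and W: "\<And>w x. w < l \<Longrightarrow> x \<in> set_pmf (q w) \<Longrightarrow> W x = w"
    and C': "\<And>x y. C' x = C' y \<longleftrightarrow> C x = C y \<and> W x = W y"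
  shows "cmi (bind_pmf (pmf_of_set {..<l}) q) A B C' = (\<Sum>w<l. cmi (q w) A B C) / real l"
proof -
  let ?p = "bind_pmf (pmf_of_set {..<l}) q"
  have "cmi ?p A B C' =
     ent ?p (\<lambda>x. ((A x, C x), W x)) + ent ?p (\<lambda>x. ((B x, C x), W x)) - ent ?p (\<lambda>x. ((A x, B x, C x), W x))
       - ent ?p (\<lambda>x. (C x, W x))"
    unfolding cmi_def by (intro arg_cong2[where f="(-)"] arg_cong2[where f="(+)"] ent_cong) (auto simp: C')
  also have "\<dots> = (\<Sum>w<l. cmi (q w) A B C) / real l"
    by (subst ent_mixture[of l q W, OF l fin W], assumption+)+
      (simp add: cmi_def sum.distrib sum_subtractf diff_divide_distrib add_divide_distrib)
  finally show ?thesis .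
qed

section \<open>Chain rules and their consequences\<close>

lemma cmi_chain: "cmi p A (\<lambda>x. (S x, B x)) C = cmi p A S C + cmi p A B (\<lambda>x. (S x, C x))"
proof -
  have "ent p (\<lambda>x. ((S x, B x), C x)) = ent p (\<lambda>x. (B x, S x, C x))"
    "ent p (\<lambda>x. (A x, (S x, B x), C x)) = ent p (\<lambda>x. (A x, B x, S x, C x))"
    by (intro ent_cong; auto)+
  then show ?thesis
    by (simp add: cmi_def)
qed

text \<open>Independence gives \<open>I[A : S | C] = 0\<close>, so by the chain rule conditioning on
  \<open>S\<close> is worth the same as revealing \<open>S\<close> together with \<open>V\<close>.
  Revealing only \<open>g (S x)\<close> can give no more.\<close>

lemma cmi_le_of_indep:
  assumes fin: "finite (set_pmf p)"
    and indep: "map_pmf (\<lambda>x. ((A x, C x), S x)) p = pair_pmf (map_pmf (\<lambda>x. (A x, C x)) p) (map_pmf S p)"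
  shows "cmi p A (\<lambda>x. (g (S x), V x)) C \<le> cmi p A V (\<lambda>x. (S x, C x))"
proof -
  have indep': "map_pmf (\<lambda>x. (C x, S x)) p = pair_pmf (map_pmf C p) (map_pmf S p)"
  proof -
    have "map_pmf (\<lambda>x. (C x, S x)) p = map_pmf (\<lambda>(y, s). (snd y, s)) (map_pmf (\<lambda>x. ((A x, C x), S x)) p)"
      by (simp add: pmf.map_comp o_def)
    also have "\<dots> = map_pmf (\<lambda>(y, s). (snd y, id s)) (pair_pmf (map_pmf (\<lambda>x. (A x, C x)) p) (map_pmf S p))"
      unfolding indep by simp
    also have "\<dots> = pair_pmf (map_pmf C p) (map_pmf S p)"
      unfolding map_pair by (simp add: pmf.map_comp o_def)
    finally show ?thesis .
  qed
  have "cmi p A S C = 0"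
  proof -
    have "ent p (\<lambda>x. (S x, C x)) = ent p (\<lambda>x. (C x, S x))"
      "ent p (\<lambda>x. (A x, S x, C x)) = ent p (\<lambda>x. ((A x, C x), S x))"
      by (intro ent_cong; auto)+
    then show ?thesis
      using ent_indep[OF fin indep] ent_indep[OF fin indep'] by (simp add: cmi_def)
  qed
  then have "cmi p A V (\<lambda>x. (S x, C x)) = cmi p A (\<lambda>x. (S x, V x)) C"
    by (simp add: cmi_chain)
  \<comment> \<open>Adding \<open>g (S x)\<close> next to \<open>S x\<close> changes no fibre, and
    it allows the chain rule to split off \<open>S\<close> as a nonnegative term.\<close>
  also have "\<dots> = cmi p A (\<lambda>x. ((g (S x), V x), S x)) C"
    by (intro cmi_cong) auto
  also have "\<dots> = cmi p A (\<lambda>x. (g (S x), V x)) C + cmi p A S (\<lambda>x. ((g (S x), V x), C x))"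
    by (rule cmi_chain)
  finally show ?thesis
    using cmi_nonneg[OF fin, of A S "\<lambda>x. ((g (S x), V x), C x)"] by simp
qed

lemma cmi_sym: "cmi p A B C = cmi p B A C"
proof -
  have "ent p (\<lambda>x. (A x, B x, C x)) = ent p (\<lambda>x. (B x, A x, C x))"
    by (intro ent_cong) auto
  then show ?thesis
    by (simp add: cmi_def)
qed

text \<open>Induction that adds the indices in increasing order of \<open>pos\<close>: the
  predecessors of the new index are all earlier ones, and those of the earlier indices do not
  change. Integer positions allow an order to be reversed by negation.\<close>

lemma cmi_chain_sum:
  fixes pos :: "'i \<Rightarrow> int" and f :: "'a \<Rightarrow> 'i \<Rightarrow> 'c"
  assumes "finite T" "inj_on pos T"
  shows "(\<Sum>t\<in>T. cmi p (\<lambda>y. f y t) V (\<lambda>y. (restrict (f y) {j\<in>T. pos j < pos t}, C y)))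
    = cmi p (\<lambda>y. restrict (f y) T) V C"
  using assms
proof (induction rule: finite_ranking_induct[where f = pos])
  case empty
  have "ent p (\<lambda>x. (u, C x)) = ent p C" "ent p (\<lambda>x. (u, V x, C x)) = ent p (\<lambda>x. (V x, C x))" for u :: "'i \<Rightarrow> 'c"
    by (intro ent_cong; simp)+
  then show ?case
    by (simp add: cmi_def restrict_def)
next
  case (insert x S)
  show ?case
  proof (cases "x \<in> S")
    case True
    then show ?thesis
      using insert by (simp add: insert_absorb)
  next
    case False
    have less: "pos y < pos x" if "y \<in> S" for y
    proof -
      have "pos y \<noteq> pos x"
        using inj_onD[OF insert.prems, of y x] False that by auto
      then show ?thesis
        using insert.hyps(2)[OF that] by simp
    qed
    have x: "{j \<in> insert x S. pos j < pos x} = S"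
      using less by auto
    have S: "{j \<in> insert x S. pos j < pos t} = {j \<in> S. pos j < pos t}" if "t \<in> S" for t
      using less[OF that] by auto
    have "(\<Sum>t\<in>insert x S. cmi p (\<lambda>y. f y t) V (\<lambda>y. (restrict (f y) {j\<in>insert x S. pos j < pos t}, C y)))
      = cmi p (\<lambda>y. f y x) V (\<lambda>y. (restrict (f y) S, C y)) + cmi p (\<lambda>y. restrict (f y) S) V C"
    proof -
      have "cmi p (\<lambda>y. restrict (f y) S) V C
        = (\<Sum>t\<in>S. cmi p (\<lambda>y. f y t) V (\<lambda>y. (restrict (f y) {j\<in>S. pos j < pos t}, C y)))"
        using insert.IH[OF inj_on_subset[OF insert.prems]] by (simp only: subset_insertI)
      also have "\<dots> = (\<Sum>t\<in>S. cmi p (\<lambda>y. f y t) V (\<lambda>y. (restrict (f y) {j\<in>insert x S. pos j < pos t}, C y)))"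
        by (intro sum.cong refl) (simp only: S)
      finally show ?thesis
        by (simp only: sum.insert[OF insert.hyps(1) False] x)
    qed
    also have "\<dots> = cmi p (\<lambda>y. (restrict (f y) S, f y x)) V C"
      using cmi_chain[of p V "\<lambda>y. restrict (f y) S" "\<lambda>y. f y x" C]
      by (simp add: cmi_sym[of p V] )
    also have "\<dots> = cmi p (\<lambda>y. restrict (f y) (insert x S)) V C"
      by (intro cmi_cong) (auto simp: fun_eq_iff restrict_def)
    finally show ?thesis .
  qed
qed

section \<open>Products of probability mass functions\<close>

lemma Pi_pmf_pair:
  assumes "finite A"
  shows "Pi_pmf A (a, b) (\<lambda>x. pair_pmf (p x) (q x))
    = map_pmf (\<lambda>(f, g) x. (f x, g x)) (pair_pmf (Pi_pmf A a p) (Pi_pmf A b q))"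
  (is "?l = ?r")
proof -
  have "?l = Pi_pmf A (a, b) (\<lambda>x. bind_pmf (p x) (\<lambda>y. bind_pmf (q x) (\<lambda>z. return_pmf (y, z))))"
    by (simp add: pair_pmf_def)
  also have "\<dots> = do {f \<leftarrow> Pi_pmf A a p; g \<leftarrow> Pi_pmf A b q;
      return_pmf (\<lambda>x. if x \<in> A then (f x, g x) else (a, b))}"
    using assms
    by (subst Pi_pmf_bind[where d' = a], simp, subst Pi_pmf_bind[where d' = b], simp, simp)
  also have "\<dots> = do {f \<leftarrow> Pi_pmf A a p; g \<leftarrow> Pi_pmf A b q; return_pmf (\<lambda>x. (f x, g x))}"
    using set_Pi_pmf_subset[OF assms, of a p] set_Pi_pmf_subset[OF assms, of b q]
    by (intro bind_pmf_cong refl arg_cong[where f=return_pmf]) fastforce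
  also have "\<dots> = ?r"
    by (simp add: pair_pmf_def map_bind_pmf)
  finally show ?thesis .
qed

text \<open>The condition on the default values allows the index-dependent map to be applied at
  every index, without a case distinction on \<open>A\<close>.\<close>

lemma Pi_pmf_map_dep:
  assumes "finite A" and "\<And>x. x \<notin> A \<Longrightarrow> f x d = d'"
  shows "Pi_pmf A d' (\<lambda>x. map_pmf (f x) (p x)) = map_pmf (\<lambda>g x. f x (g x)) (Pi_pmf A d p)"
proof -
  have "Pi_pmf A d' (\<lambda>x. map_pmf (f x) (p x))
      = do {g \<leftarrow> Pi_pmf A d p; return_pmf (\<lambda>x. if x \<in> A then f x (g x) else d')}"
    unfolding map_pmf_def using assms by (subst Pi_pmf_bind[where d' = d]) simp_all
  also have "\<dots> = do {g \<leftarrow> Pi_pmf A d p; return_pmf (\<lambda>x. f x (g x))}"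
    using set_Pi_pmf_subset[OF assms(1), of d p] assms(2)
    by (intro bind_pmf_cong refl arg_cong[where f=return_pmf]) fastforce
  finally show ?thesis
    by (simp add: map_pmf_def)
qed

text \<open>Transposition of a matrix of independent entries, by induction on the rows. It turns
  bits drawn processor by processor into bits drawn column by column.\<close>

lemma Pi_pmf_swap:
  assumes "finite A" "finite B"
  shows "map_pmf (\<lambda>f y x. f x y) (Pi_pmf A (\<lambda>_. d) (\<lambda>x. Pi_pmf B d (\<lambda>y. p x y)))
    = Pi_pmf B (\<lambda>_. d) (\<lambda>y. Pi_pmf A d (\<lambda>x. p x y))"
  using assms(1)
proof (induction rule: finite_induct)
  case empty
  then show ?case
    using assms(2) by (simp add: Pi_pmf_return_pmf)
next
  case (insert a A)
  let ?Q = "Pi_pmf A (\<lambda>_. d) (\<lambda>x. Pi_pmf B d (\<lambda>y. p x y))"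
  have "map_pmf (\<lambda>f y x. f x y) (Pi_pmf (insert a A) (\<lambda>_. d) (\<lambda>x. Pi_pmf B d (\<lambda>y. p x y)))
     = map_pmf (\<lambda>(r, f) y. (f y)(a := r y)) (pair_pmf (Pi_pmf B d (p a)) (map_pmf (\<lambda>f y x. f x y) ?Q))"
    using insert.hyps
    by (subst Pi_pmf_insert) (auto simp: pair_map_pmf2 pmf.map_comp o_def fun_eq_iff intro!: map_pmf_cong)
  also have "\<dots> = map_pmf (\<lambda>(r, f) y. (f y)(a := r y)) (pair_pmf (Pi_pmf B d (p a)) (Pi_pmf B (\<lambda>_. d) (\<lambda>y. Pi_pmf A d (\<lambda>x. p x y))))"
    by (simp only: insert.IH)
  also have "\<dots> = map_pmf (\<lambda>g y. (\<lambda>(r, f). f(a := r)) (g y))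
      (map_pmf (\<lambda>(f, g) x. (f x, g x)) (pair_pmf (Pi_pmf B d (p a)) (Pi_pmf B (\<lambda>_. d) (\<lambda>y. Pi_pmf A d (\<lambda>x. p x y)))))"
    unfolding pmf.map_comp by (intro map_pmf_cong) auto
  also have "\<dots> = Pi_pmf B (\<lambda>_. d) (\<lambda>y. map_pmf (\<lambda>(r, f). f(a := r)) (pair_pmf (p a y) (Pi_pmf A d (\<lambda>x. p x y))))"
    using assms(2) by (subst Pi_pmf_pair[symmetric], simp, subst Pi_pmf_map_dep[where d="(d, \<lambda>_. d)"]) (auto simp: fun_eq_iff)
  also have "\<dots> = Pi_pmf B (\<lambda>_. d) (\<lambda>y. Pi_pmf (insert a A) d (\<lambda>x. p x y))"
    using insert.hyps by (simp add: Pi_pmf_insert)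
  finally show ?case .
qed

text \<open>Overwriting two coordinates of an i.i.d. family by fresh draws from the same
  distribution does not change its law.\<close>

lemma Pi_pmf_embed_two:
  assumes st: "s < l" "t < l" "s \<noteq> (t::nat)"
  shows "map_pmf (\<lambda>(f, g) j. if j = s then f 0 else if j = t then f 1 else g j)
      (pair_pmf (Pi_pmf {..<2::nat} d (\<lambda>_. p)) (Pi_pmf {..<l} d (\<lambda>_. p)))
    = Pi_pmf {..<l} d (\<lambda>_. p)"
proof -
  \<comment> \<open>The shift by two keeps all indices other than \<open>s\<close> and
    \<open>t\<close> away from \<open>{..<2}\<close>, as reindexing by \<open>h\<close> has to send
    indices outside \<open>{s, t}\<close> to default values.\<close>
  define h where "h j = (if j = s then 0 else if j = t then 1 else Suc (Suc j))" for j
  have 1: "Pi_pmf {s, t} d (\<lambda>_. p) = map_pmf (\<lambda>g. g \<circ> h) (Pi_pmf {..<2} d (\<lambda>_. p))"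
    using st by (intro Pi_pmf_bij_betw) (auto simp: h_def bij_betw_def inj_on_def lessThan_nat_numeral lessThan_Suc)
  let ?R = "{..<l} - {s, t}"
  have 2: "Pi_pmf ?R d (\<lambda>_. p) = map_pmf (\<lambda>f x. if x \<in> ?R then f x else d) (Pi_pmf {..<l} d (\<lambda>_. p))"
    by (intro Pi_pmf_subset) auto
  have "Pi_pmf {..<l} d (\<lambda>_. p) = Pi_pmf ({s, t} \<union> ?R) d (\<lambda>_. p)"
    using st by (intro arg_cong[where f="\<lambda>A. Pi_pmf A d (\<lambda>_. p)"]) auto
  also have "\<dots> = map_pmf (\<lambda>(f, g) x. if x \<in> {s, t} then f x else g x)
     (pair_pmf (Pi_pmf {s, t} d (\<lambda>_. p)) (Pi_pmf ?R d (\<lambda>_. p)))"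
    by (intro Pi_pmf_union) auto
  also have "\<dots> = map_pmf (\<lambda>(f, g) j. if j = s then f 0 else if j = t then f 1 else g j)
      (pair_pmf (Pi_pmf {..<2::nat} d (\<lambda>_. p)) (Pi_pmf {..<l} d (\<lambda>_. p)))"
    unfolding 1 2 pair_map_pmf1 pair_map_pmf2 pmf.map_comp
    using set_Pi_pmf_subset[of "{..<l}" d "\<lambda>_. p"] st
    by (intro map_pmf_cong refl) (fastforce simp: h_def)
  finally show ?thesis ..
qed

lemma Pi_pmf_indep:
  assumes "finite A" "K \<subseteq> A"
    and F: "\<And>f g. (\<And>x. x \<in> K \<Longrightarrow> f x = g x) \<Longrightarrow> F f = F g"
    and G: "\<And>f g. (\<And>x. x \<notin> K \<Longrightarrow> f x = g x) \<Longrightarrow> G f = G g"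
  shows "map_pmf (\<lambda>f. (F f, G f)) (Pi_pmf A d p) = pair_pmf (map_pmf F (Pi_pmf A d p)) (map_pmf G (Pi_pmf A d p))"
proof -
  let ?P = "pair_pmf (Pi_pmf K d p) (Pi_pmf (A - K) d p)"
  have A: "Pi_pmf A d p = map_pmf (\<lambda>(f, g) x. if x \<in> K then f x else g x) ?P"
    using assms(1,2) Pi_pmf_union[of K "A - K" d p] finite_subset by (auto simp: Un_absorb1)
  have F': "F (\<lambda>x. if x \<in> K then f x else g x) = F f" for f g
    by (rule F) auto
  have G': "G (\<lambda>x. if x \<in> K then f x else g x) = G g" for f g
    by (rule G) auto
  have "map_pmf (\<lambda>f. (F f, G f)) (Pi_pmf A d p) = pair_pmf (map_pmf F (Pi_pmf K d p)) (map_pmf G (Pi_pmf (A - K) d p))"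
    unfolding A map_pair[symmetric] pmf.map_comp by (intro map_pmf_cong) (auto simp: F' G')
  moreover have "map_pmf F (Pi_pmf A d p) = map_pmf F (map_pmf fst ?P)"
    unfolding A pmf.map_comp by (intro map_pmf_cong) (auto simp: F')
  moreover have "map_pmf G (Pi_pmf A d p) = map_pmf G (map_pmf snd ?P)"
    unfolding A pmf.map_comp by (intro map_pmf_cong) (auto simp: G')
  ultimately show ?thesis
    by (simp add: map_fst_pair_pmf map_snd_pair_pmf)
qed

section \<open>Averaging, and coding discrete distributions as coins\<close>

lemma prob_bind_pmf_ge:
  assumes "\<And>y. y \<in> set_pmf p \<Longrightarrow> c \<le> measure_pmf.prob (q y) E"
  shows "c \<le> measure_pmf.prob (bind_pmf p q) E"
proof -
  have "integrable p (\<lambda>y. measure_pmf.prob (q y) E)"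
    by (intro measure_pmf.integrable_const_bound[where B=1]) auto
  then have "(\<integral>y. c \<partial>p) \<le> (\<integral>y. measure_pmf.prob (q y) E \<partial>p)"
    using assms by (intro integral_mono_AE AE_pmfI) simp_all
  also have "\<dots> = measure_pmf.prob (bind_pmf p q) E"
    unfolding measure_pmf_bind
    by (subst measure_pmf.measure_bind[where N="count_space UNIV"]) (simp_all add: measure_pmf_in_subprob_space)
  finally show ?thesis
    by simp
qed

text \<open>Coins of a protocol are natural numbers, so a sample from a countable support is
  replaced by its index in an enumeration of that support.\<close>

definition code_pmf :: "'a pmf \<Rightarrow> nat pmf" where
  "code_pmf p = map_pmf (to_nat_on (set_pmf p)) p"

definition decode_pmf :: "'a pmf \<Rightarrow> nat \<Rightarrow> 'a" where
  "decode_pmf p = from_nat_into (set_pmf p)"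

lemma map_decode_pmf: "map_pmf (decode_pmf p) (code_pmf p) = p"
proof -
  have "map_pmf (\<lambda>x. decode_pmf p (to_nat_on (set_pmf p) x)) p = map_pmf id p"
    by (intro map_pmf_cong) (auto simp: decode_pmf_def)
  then show ?thesis
    by (simp add: code_pmf_def pmf.map_comp o_def)
qed

text \<open>Enumeration of a nonempty set is total, so every natural number decodes into the
  support, whether or not it is a code.\<close>

lemma decode_pmf_in_set: "decode_pmf p n \<in> set_pmf p"
  by (simp add: decode_pmf_def from_nat_into set_pmf_not_empty)

section \<open>The column distribution\<close>

text \<open>The column as a deterministic function of \<open>m\<close>, \<open>z\<close> and raw
  uniform bits \<open>u\<close>. Entry \<open>i\<close> reads only \<open>u i\<close>, so each
  processor can draw its own entry once it knows \<open>m\<close> and \<open>z\<close>.\<close>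

definition column_bits :: "nat \<Rightarrow> bool \<Rightarrow> nat \<Rightarrow> (nat \<Rightarrow> bool) \<Rightarrow> nat \<Rightarrow> bool" where
  "column_bits k m z u i \<longleftrightarrow> i < k \<and> i \<noteq> z \<and> (m \<or> u i)"

abbreviation bits :: "nat \<Rightarrow> (nat \<Rightarrow> bool) pmf" where
  "bits n \<equiv> Pi_pmf {..<n} False (\<lambda>_. bernoulli_pmf (1/2))"

lemma zeta_column_eq:
  "zeta_column k = do {m \<leftarrow> bernoulli_pmf (1/3); z \<leftarrow> pmf_of_set {..<k}; u \<leftarrow> bits k;
     return_pmf (m, z, column_bits k m z u)}"
proof -
  have "Pi_pmf {..<k} False (\<lambda>i. if i = z then return_pmf False else if m then return_pmf True
      else bernoulli_pmf (1/2)) = map_pmf (column_bits k m z) (bits k)" for m z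
  proof -
    have "(\<lambda>i. if i = z then return_pmf False else if m then return_pmf True else bernoulli_pmf (1/2))
        = (\<lambda>i. map_pmf (\<lambda>b. i \<noteq> z \<and> (m \<or> b)) (bernoulli_pmf (1/2)))"
      by (auto simp: fun_eq_iff map_pmf_const)
    then have "Pi_pmf {..<k} False (\<lambda>i. if i = z then return_pmf False else if m then return_pmf True
      else bernoulli_pmf (1/2)) = Pi_pmf {..<k} False (\<lambda>i. map_pmf (\<lambda>b. i < k \<and> i \<noteq> z \<and> (m \<or> b)) (bernoulli_pmf (1/2)))"
      by (intro Pi_pmf_cong) (auto simp: fun_eq_iff)
    also have "\<dots> = map_pmf (\<lambda>u i. i < k \<and> i \<noteq> z \<and> (m \<or> u i)) (bits k)"
      by (rule Pi_pmf_map_dep) auto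
    finally show ?thesis
      by (simp add: column_bits_def[abs_def])
  qed
  then show ?thesis
    by (simp add: zeta_column_def map_pmf_def bind_assoc_pmf bind_return_pmf)
qed

abbreviation resample :: "nat \<Rightarrow> bool \<times> nat \<times> (nat \<Rightarrow> bool) \<Rightarrow> (nat \<Rightarrow> bool) \<Rightarrow> bool \<times> nat \<times> (nat \<Rightarrow> bool)" where
  "resample k c u \<equiv> (fst c, fst (snd c), column_bits k (fst c) (fst (snd c)) u)"

text \<open>Given \<open>M\<close> and \<open>Z\<close>, the redrawn entries have the conditional
  law of the original ones, so the joint law is preserved.\<close>

lemma resample_zeta_column:
  "map_pmf (\<lambda>(c, u). resample k c u) (pair_pmf (zeta_column k) (bits k)) = zeta_column k"
  by (simp add: zeta_column_eq pair_pmf_def map_bind_pmf bind_assoc_pmf bind_return_pmf)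

abbreviation default_column :: "bool \<times> nat \<times> (nat \<Rightarrow> bool)" where
  "default_column \<equiv> (False, 0, \<lambda>_. False)"

abbreviation zeta_columns :: "nat \<Rightarrow> nat \<Rightarrow> (nat \<Rightarrow> bool \<times> nat \<times> (nat \<Rightarrow> bool)) pmf" where
  "zeta_columns k l \<equiv> Pi_pmf {..<l} default_column (\<lambda>_. zeta_column k)"

text \<open>\<open>V\<close> is indexed by processors first because each of them draws its bits
  privately. After transposition every column in \<open>A\<close> has its own fresh bits and is
  resampled separately.\<close>

lemma resample_zeta_columns:
  "map_pmf (\<lambda>(C, V) j. if j \<in> A then resample k (C j) (\<lambda>i. V i j) else C j)
     (pair_pmf (zeta_columns k l) (Pi_pmf {..<k} (\<lambda>_. False) (\<lambda>_. bits l))) = zeta_columns k l"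
  (is "map_pmf ?F (pair_pmf _ ?V) = _")
proof -
  let ?V' = "Pi_pmf {..<l} (\<lambda>_. False) (\<lambda>_. bits k)"
  let ?f = "\<lambda>j (c, u). if j \<in> A then resample k c u else c"
  have "map_pmf ?F (pair_pmf (zeta_columns k l) ?V)
     = map_pmf (\<lambda>g j. ?f j (g j)) (map_pmf (\<lambda>(f, g) x. (f x, g x)) (pair_pmf (zeta_columns k l) (map_pmf (\<lambda>V j i. V i j) ?V)))"
    unfolding pair_map_pmf2 pmf.map_comp by (intro map_pmf_cong) (auto simp: fun_eq_iff)
  also have "\<dots> = map_pmf (\<lambda>g j. ?f j (g j)) (map_pmf (\<lambda>(f, g) x. (f x, g x)) (pair_pmf (zeta_columns k l) ?V'))"
    by (simp only: Pi_pmf_swap finite_lessThan)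
  also have "\<dots> = Pi_pmf {..<l} default_column (\<lambda>j. map_pmf (?f j) (pair_pmf (zeta_column k) (bits k)))"
    by (subst Pi_pmf_pair[symmetric], simp, subst Pi_pmf_map_dep[where d="(default_column, \<lambda>_. False)"])
       (auto simp: column_bits_def fun_eq_iff)
  also have "\<dots> = zeta_columns k l"
  proof (intro Pi_pmf_cong refl)
    fix j
    show "map_pmf (?f j) (pair_pmf (zeta_column k) (bits k)) = zeta_column k"
    proof (cases "j \<in> A")
      case True
      then show ?thesis
        by (simp add: resample_zeta_column)
    next
      case False
      then show ?thesis
        by (simp add: case_prod_unfold map_fst_pair_pmf)
    qed
  qed
  finally show ?thesis .
qed

lemma set_zeta_columnD:
  assumes "c \<in> set_pmf (zeta_column k)" "k > 0"
  shows "fst (snd c) < k \<and> \<not> snd (snd c) (fst (snd c)) \<and> (\<forall>i. snd (snd c) i \<longrightarrow> i < k)"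
  using assms by (auto simp: zeta_column_eq column_bits_def lessThan_empty_iff)

lemma finite_set_zeta_column:
  assumes "k > 0"
  shows "finite (set_pmf (zeta_column k))"
  using assms
  by (auto simp: zeta_column_eq set_Pi_pmf lessThan_empty_iff intro!: finite_PiE_dflt)

lemma finite_set_zeta_columns:
  assumes "k > 0"
  shows "finite (set_pmf (zeta_columns k l))"
  using assms by (auto simp: set_Pi_pmf finite_set_zeta_column intro!: finite_PiE_dflt)

lemma set_zeta_columnsD:
  assumes "C \<in> set_pmf (zeta_columns k l)"
  shows "j < l \<Longrightarrow> C j \<in> set_pmf (zeta_column k)" "\<not> j < l \<Longrightarrow> C j = default_column"
  using assms by (auto simp: set_Pi_pmf PiE_dflt_def)

section \<open>Decomposition of the cost by the planted column\<close>

type_synonym column_data = "nat \<Rightarrow> bool \<times> nat \<times> (nat \<Rightarrow> bool)"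

lemma history_upto_mono: "set (history_upto P X c r n) \<subseteq> set (history_upto P X c r (n + m))"
  by (induction m) (auto simp: Let_def split: action.splits)

lemma length_history_upto: "length (history_upto P X c r n) \<le> n"
  by (induction n) (auto simp: Let_def split: action.splits)

definition planted :: "nat \<Rightarrow> nat \<Rightarrow> column_data \<Rightarrow> matrix" where
  "planted k w C i t = (if t = w then i < k else snd (snd (C t)) i)"

text \<open>The law of the columns before planting and of the transcript, given \<open>W = w\<close>.\<close>
definition slice :: "nat \<Rightarrow> nat \<Rightarrow> protocol \<Rightarrow> nat \<Rightarrow> (column_data \<times> history) pmf" where
  "slice k l P w = do {C \<leftarrow> zeta_columns k l; (h, a) \<leftarrow> run k P (planted k w C); return_pmf (C, h)}"

abbreviation Mof :: "column_data \<times> history \<Rightarrow> nat \<Rightarrow> bool" where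
  "Mof y t \<equiv> fst (fst y t)"

abbreviation Zof :: "column_data \<times> history \<Rightarrow> nat \<Rightarrow> nat" where
  "Zof y t \<equiv> fst (snd (fst y t))"

text \<open>The columns are recorded before planting, so their law is i.i.d. whatever the protocol
  and the planted column.\<close>

lemma map_fst_slice: "map_pmf fst (slice k l P w) = zeta_columns k l"
  by (simp add: slice_def map_bind_pmf case_prod_unfold bind_return_pmf')

lemma joint_eq:
  "joint k l P = bind_pmf (pmf_of_set {..<l}) (\<lambda>w. map_pmf
     (\<lambda>y. (planted k w (fst y), Mof y, Zof y, w, snd y)) (slice k l P w))"
proof -
  have "joint k l P = do {C \<leftarrow> zeta_columns k l; w \<leftarrow> pmf_of_set {..<l}; (h, a) \<leftarrow> run k P (planted k w C);
     return_pmf (planted k w C, \<lambda>t. fst (C t), \<lambda>t. fst (snd (C t)), w, h)}"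
    by (simp add: joint_def zeta_def bind_assoc_pmf bind_return_pmf planted_def[abs_def])
  also have "\<dots> = do {w \<leftarrow> pmf_of_set {..<l}; C \<leftarrow> zeta_columns k l; (h, a) \<leftarrow> run k P (planted k w C);
     return_pmf (planted k w C, \<lambda>t. fst (C t), \<lambda>t. fst (snd (C t)), w, h)}"
    by (rule bind_commute_pmf)
  also have "\<dots> = bind_pmf (pmf_of_set {..<l}) (\<lambda>w. map_pmf
     (\<lambda>y. (planted k w (fst y), Mof y, Zof y, w, snd y)) (slice k l P w))"
    by (simp add: slice_def map_bind_pmf case_prod_unfold)
  finally show ?thesis .
qed

lemma planted_in_matrices:
  assumes "C \<in> set_pmf (zeta_columns k l)" "w < l" "k > 0"
  shows "planted k w C \<in> matrices k l"
proof -
  have "i < k \<and> j < l" if b: "planted k w C i j" for i j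
  proof -
    have "j < l \<longrightarrow> (\<forall>i. snd (snd (C j)) i \<longrightarrow> i < k)" "\<not> j < l \<longrightarrow> C j = default_column"
      using set_zeta_columnsD[OF assms(1), of j] set_zeta_columnD[of "C j" k] assms(3) by auto
    then show ?thesis
      using b assms(2) by (auto simp: planted_def split: if_splits)
  qed
  then show ?thesis
    by (auto simp: matrices_def)
qed

text \<open>Bounded message lengths and a bounded number of rounds leave only finitely many
  histories. This is what makes the entropy identities applicable.\<close>

lemma finite_set_slice:
  assumes P: "is_protocol k l P" and "k > 0" "w < l"
  shows "finite (set_pmf (slice k l P w))"
proof -
  obtain B where B: "\<And>X c r. X \<in> matrices k l \<Longrightarrow> c \<in> set_pmf (coord_coins P) \<Longrightarrow>
      (\<And>i. i < k \<Longrightarrow> r i \<in> set_pmf (proc_coins P i)) \<Longrightarrow>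
      (\<forall>(i, m, m') \<in> set (transcript P X c r). i < k \<and> length m \<le> B \<and> length m' \<le> B)"
    using P unfolding is_protocol_def by blast
  define L where "L = {m :: message. set m \<subseteq> UNIV \<and> length m \<le> B}"
  define H where "H = {h :: history. set h \<subseteq> {..<k} \<times> L \<times> L \<and> length h \<le> max_rounds P}"
  have "finite L"
    unfolding L_def by (intro finite_lists_length_le) simp
  then have "finite H"
    unfolding H_def by (intro finite_lists_length_le) auto
  moreover have "set_pmf (slice k l P w) \<subseteq> set_pmf (zeta_columns k l) \<times> H"
  proof
    fix y assume "y \<in> set_pmf (slice k l P w)"
    then obtain C c r where C: "C \<in> set_pmf (zeta_columns k l)" and c: "c \<in> set_pmf (coord_coins P)"
      and r: "r \<in> set_pmf (Pi_pmf {..<k} 0 (proc_coins P))" and y: "y = (C, transcript P (planted k w C) c r)"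
      by (auto simp: slice_def run_def Let_def)
    have "\<forall>(i, m, m') \<in> set (transcript P (planted k w C) c r). i < k \<and> length m \<le> B \<and> length m' \<le> B"
      using C c r assms by (intro B planted_in_matrices) (auto simp: set_Pi_pmf PiE_dflt_def)
    then have "transcript P (planted k w C) c r \<in> H"
      using length_history_upto[of P "planted k w C" c r "max_rounds P"]
      by (auto simp: H_def L_def transcript_def)
    then show "y \<in> set_pmf (zeta_columns k l) \<times> H"
      using C y by simp
  qed
  ultimately show ?thesis
    using finite_subset finite_set_zeta_columns[OF \<open>k > 0\<close>, of l] by blast
qed

text \<open>The two cost terms of processor \<open>i\<close> given \<open>W = w\<close>;
  \<open>W\<close> is constant on the slice and therefore absent from the conditions.\<close>

definition cost :: "nat \<Rightarrow> nat \<Rightarrow> protocol \<Rightarrow> nat \<Rightarrow> nat \<Rightarrow> real" where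
  "cost k l P w i =
     cmi (slice k l P w) (\<lambda>y. drop_coord l w (Mof y)) (\<lambda>y. view i (snd y)) (\<lambda>y. (planted k w (fst y) i, Zof y))
   + cmi (slice k l P w) (\<lambda>y. drop_coord l w (planted k w (fst y) i)) (\<lambda>y. view i (snd y)) (\<lambda>y. (Mof y, Zof y))"

lemma PIC_eq:
  assumes P: "is_protocol k l P" and "k > 0" "l > 0"
  shows "PIC k l P = (\<Sum>w<l. \<Sum>i<k. cost k l P w i) / real l"
proof -
  define q where "q w = map_pmf (\<lambda>y. (planted k w (fst y), Mof y, Zof y, w, snd y)) (slice k l P w)" for w
  have J: "joint k l P = bind_pmf (pmf_of_set {..<l}) q"
    unfolding q_def by (rule joint_eq)
  have fin: "finite (set_pmf (q w))" if "w < l" for w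
    using that assms by (auto simp: q_def finite_set_slice)
  have "finite (set_pmf (joint k l P))"
    unfolding J using fin \<open>l > 0\<close> by (auto simp: lessThan_empty_iff)
  note eq = cond_mutual_info_eq_cmi[OF this]
  let ?W = "\<lambda>(X :: matrix, M :: nat \<Rightarrow> bool, Z :: nat \<Rightarrow> nat, W :: nat, h :: history). W"
  have W: "?W x = w" if "w < l" "x \<in> set_pmf (q w)" for w x
    using that by (auto simp: q_def)
  have 1: "cmi (joint k l P) (\<lambda>(X, M, Z, W, h). drop_coord l W M) (\<lambda>(X, M, Z, W, h). view i h) (\<lambda>(X, M, Z, W, h). (X i, Z, W))
    = (\<Sum>w<l. cmi (slice k l P w) (\<lambda>y. drop_coord l w (Mof y)) (\<lambda>y. view i (snd y)) (\<lambda>y. (planted k w (fst y) i, Zof y))) / real l" for i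
    unfolding J by (subst cmi_mixture[where C="\<lambda>(X, M, Z, W, h). (X i, Z)" and W="?W", OF \<open>l > 0\<close> fin W])
      (auto simp: q_def cmi_map)
  have 2: "cmi (joint k l P) (\<lambda>(X, M, Z, W, h). drop_coord l W (X i)) (\<lambda>(X, M, Z, W, h). view i h) (\<lambda>(X, M, Z, W, h). (M, Z, W))
    = (\<Sum>w<l. cmi (slice k l P w) (\<lambda>y. drop_coord l w (planted k w (fst y) i)) (\<lambda>y. view i (snd y)) (\<lambda>y. (Mof y, Zof y))) / real l" for i
    unfolding J by (subst cmi_mixture[where C="\<lambda>(X, M, Z, W, h). (M, Z)" and W="?W", OF \<open>l > 0\<close> fin W])
      (auto simp: q_def cmi_map)
  have "PIC k l P = (\<Sum>i<k. (\<Sum>w<l. cost k l P w i) / real l)"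
    unfolding PIC_def eq 1 2 by (simp add: cost_def sum.distrib add_divide_distrib)
  also have "\<dots> = (\<Sum>w<l. \<Sum>i<k. cost k l P w i) / real l"
    by (subst sum.swap) (simp add: sum_divide_distrib)
  finally show ?thesis .
qed

lemma cost_nonneg:
  assumes "is_protocol k l P" "k > 0" "w < l"
  shows "0 \<le> cost k l P w i"
  unfolding cost_def by (intro add_nonneg_nonneg cmi_nonneg finite_set_slice assms)

lemma PIC_nonneg:
  assumes "is_protocol k l P" "k > 0" "l > 0"
  shows "0 \<le> PIC k l P"
  unfolding PIC_eq[OF assms] using assms by (intro divide_nonneg_nonneg sum_nonneg cost_nonneg) auto

text \<open>The terms of column \<open>t\<close> in the two chain rules for \<open>cost\<close>, if \<open>A\<close> is the set of columns before \<open>t\<close>; the second chain rule runs in the opposite order.\<close>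
definition share :: "nat \<Rightarrow> nat \<Rightarrow> protocol \<Rightarrow> nat \<Rightarrow> nat \<Rightarrow> nat \<Rightarrow> nat set \<Rightarrow> real" where
  "share k l P i w t A =
     cmi (slice k l P w) (\<lambda>y. Mof y t) (\<lambda>y. view i (snd y))
       (\<lambda>y. (restrict (Mof y) A, planted k w (fst y) i, Zof y))
   + cmi (slice k l P w) (\<lambda>y. planted k w (fst y) i t) (\<lambda>y. view i (snd y))
       (\<lambda>y. (restrict (planted k w (fst y) i) ({..<l} - {w, t} - A), Mof y, Zof y))"

text \<open>The first terms form the chain rule for \<open>M\<close> in the order
  \<open>pos\<close>, the second ones the chain rule for the row in the reversed order.\<close>

lemma sum_share:
  fixes pos :: "nat \<Rightarrow> int"
  assumes inj: "inj_on pos ({..<l} - {w})"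
  shows "(\<Sum>t\<in>{..<l} - {w}. share k l P i w t {j\<in>{..<l} - {w}. pos j < pos t}) = cost k l P w i"
proof -
  let ?T = "{..<l} - {w}"
  \<comment> \<open>As \<open>pos\<close> is injective, a column other than \<open>t\<close> that is
    not before \<open>t\<close> comes after it, hence before it in the negated order.\<close>
  have *: "{..<l} - {w, t} - {j\<in>?T. pos j < pos t} = {j\<in>?T. - pos j < - pos t}" if "t \<in> ?T" for t
  proof -
    show ?thesis
    proof (rule set_eqI)
      fix j
      have "pos j \<noteq> pos t" if "j \<in> ?T" "j \<noteq> t"
        using inj_on_eq_iff[OF inj that(1) \<open>t \<in> ?T\<close>] that(2) by simp
      then show "j \<in> {..<l} - {w, t} - {j\<in>?T. pos j < pos t} \<longleftrightarrow> j \<in> {j\<in>?T. - pos j < - pos t}"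
        by (cases "j \<in> ?T \<and> j \<noteq> t") auto
    qed
  qed
  have inj': "inj_on (\<lambda>j. - pos j) ?T"
    using inj by (auto simp: inj_on_def)
  have "(\<Sum>t\<in>?T. cmi (slice k l P w) (\<lambda>y. planted k w (fst y) i t) (\<lambda>y. view i (snd y))
       (\<lambda>y. (restrict (planted k w (fst y) i) ({..<l} - {w, t} - {j\<in>?T. pos j < pos t}), Mof y, Zof y)))
     = cmi (slice k l P w) (\<lambda>y. restrict (planted k w (fst y) i) ?T) (\<lambda>y. view i (snd y)) (\<lambda>y. (Mof y, Zof y))"
    unfolding cmi_chain_sum[OF finite_Diff[OF finite_lessThan] inj', symmetric]
    by (intro sum.cong refl) (simp only: *)
  moreover have "(\<Sum>t\<in>?T. cmi (slice k l P w) (\<lambda>y. Mof y t) (\<lambda>y. view i (snd y))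
       (\<lambda>y. (restrict (Mof y) {j\<in>?T. pos j < pos t}, planted k w (fst y) i, Zof y)))
     = cmi (slice k l P w) (\<lambda>y. restrict (Mof y) ?T) (\<lambda>y. view i (snd y)) (\<lambda>y. (planted k w (fst y) i, Zof y))"
    by (rule cmi_chain_sum[OF finite_Diff[OF finite_lessThan] inj])
  ultimately show ?thesis
    unfolding share_def cost_def sum.distrib drop_coord_def by (simp only:)
qed

section \<open>Embedding two columns\<close>

locale embedding =
  fixes k l s t :: nat and A :: "nat set" and P :: protocol
  assumes k: "k > 0" and s: "s < l" and t: "t < l" and s_t: "s \<noteq> t" and A: "A \<subseteq> {..<l} - {s, t}"
    and P: "is_protocol k l P"
begin

text \<open>What the coordinator tells processor \<open>i\<close> about the sampled columns; \<open>M\<close> outside \<open>A\<close> and the entries of row \<open>i\<close> in \<open>A\<close> are withheld.\<close>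
definition hint :: "nat \<Rightarrow> column_data \<Rightarrow> nat \<Rightarrow> bool \<times> nat \<times> bool" where
  "hint i C j = (if j = s \<or> j = t then (False, 0, False)
     else (j \<in> A \<and> fst (C j), fst (snd (C j)), j \<notin> A \<and> snd (snd (C j)) i))"

definition hints :: "(nat \<Rightarrow> bool \<times> nat \<times> bool) set" where
  "hints = (\<Union>i<k. hint i ` set_pmf (zeta_columns k l))"

text \<open>Unary code: the length of the message is the index of the hint. Finiteness of
  \<open>hints\<close> bounds these lengths.\<close>

definition enc :: "(nat \<Rightarrow> bool \<times> nat \<times> bool) \<Rightarrow> message" where
  "enc D = replicate (to_nat_on hints D) True"

definition dec :: "message \<Rightarrow> (nat \<Rightarrow> bool \<times> nat \<times> bool)" where
  "dec m = from_nat_into hints (length m)"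

lemma finite_hints: "finite hints"
  using k by (auto simp: hints_def finite_set_zeta_columns)

lemma dec_enc: "D \<in> hints \<Longrightarrow> dec (enc D) = D"
  by (simp add: dec_def enc_def finite_hints countable_finite)

lemma hint_in_hints: "i < k \<Longrightarrow> C \<in> set_pmf (zeta_columns k l) \<Longrightarrow> hint i C \<in> hints"
  by (auto simp: hints_def)

text \<open>The row on which processor \<open>i\<close> runs \<open>P\<close>, computed from its
  input, its hint and its private bits alone. The constant function supplies the one bit that
  \<open>column_bits\<close> reads at \<open>i\<close>.\<close>

definition row :: "nat \<Rightarrow> (nat \<Rightarrow> bool) \<Rightarrow> (nat \<Rightarrow> bool \<times> nat \<times> bool) \<Rightarrow> (nat \<Rightarrow> bool) \<Rightarrow> nat \<Rightarrow> bool" where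
  "row i x D u j = (if j = s then x 0 else if j = t then x 1
     else if j \<in> A then column_bits k (fst (D j)) (fst (snd (D j))) (\<lambda>_. u j) i else snd (snd (D j)))"

text \<open>The same rows seen globally, from the complete sampled columns and everybody's private
  bits; \<open>row_hint\<close> relates the two descriptions.\<close>

definition big :: "matrix \<Rightarrow> column_data \<Rightarrow> (nat \<Rightarrow> nat \<Rightarrow> bool) \<Rightarrow> matrix" where
  "big X C V i j = (if j = s then X i 0 else if j = t then X i 1
     else if j \<in> A then column_bits k (fst (C j)) (fst (snd (C j))) (\<lambda>i. V i j) i else snd (snd (C j)) i)"

lemma row_hint: "i < k \<Longrightarrow> row i (X i) (hint i C) (V i) = big X C V i"
  by (auto simp: row_def big_def hint_def column_bits_def fun_eq_iff)

text \<open>The first \<open>k\<close> rounds deliver the hints: in round \<open>n\<close> processor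
  \<open>n\<close> is addressed for the first time, so its view is empty and it replies
  \<open>[]\<close>. Afterwards \<open>P\<close> is run; \<open>drop k h\<close> and
  \<open>tl v\<close> remove the hint rounds, and \<open>hd v\<close> holds the hint. All coins are
  coded pairs of a coin of \<open>P\<close> and a sample.\<close>

definition sim :: protocol where
  "sim = \<lparr>coord_coins = map_pmf prod_encode (pair_pmf (coord_coins P) (code_pmf (zeta_columns k l))),
     proc_coins = \<lambda>i. map_pmf prod_encode (pair_pmf (proc_coins P i) (code_pmf (bits l))),
     coord_act = \<lambda>c h. if length h < k
       then Send (length h) (enc (hint (length h) (decode_pmf (zeta_columns k l) (snd (prod_decode c)))))
       else coord_act P (fst (prod_decode c)) (drop k h),
     proc_reply = \<lambda>i x r v m. if v = [] then []
       else proc_reply P i (row i x (dec (fst (hd v))) (decode_pmf (bits l) (snd (prod_decode r))))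
         (fst (prod_decode r)) (tl v) m,
     max_rounds = k + max_rounds P\<rparr>"

section \<open>Transcripts of the simulation\<close>

definition prelude :: "column_data \<Rightarrow> history" where
  "prelude C = map (\<lambda>i. (i, enc (hint i C), [])) [0..<k]"

lemma length_prelude [simp]: "length (prelude C) = k"
  by (simp add: prelude_def)

lemma view_prelude:
  assumes "i < k"
  shows "view i (prelude C @ h) = (enc (hint i C), []) # view i h"
proof -
  have "view i (map (\<lambda>i. (i, enc (hint i C), [])) [0..<n]) = (if i < n then [(enc (hint i C), [])] else [])" for n
    by (induction n) (auto simp: view_def less_Suc_eq)
  moreover have "view i (g @ h) = view i g @ view i h" for g
    by (simp add: view_def)
  ultimately show ?thesis
    using assms by (simp add: prelude_def)
qed

lemma history_sim_prelude:
  assumes "n \<le> k"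
  shows "history_upto sim X (prod_encode (c, d)) r n
    = map (\<lambda>i. (i, enc (hint i (decode_pmf (zeta_columns k l) d)), [])) [0..<n]"
  using assms
proof (induction n)
  case (Suc n)
  have "view n (map (\<lambda>i. (i, enc (hint i (decode_pmf (zeta_columns k l) d)), [])) [0..<n]) = []"
    by (auto simp: view_def filter_empty_conv)
  then show ?case
    using Suc by (simp add: sim_def Let_def)
qed simp

text \<open>After the hint rounds both runs proceed in lockstep, because every processor answers as
  \<open>P\<close> does on its row of \<open>big X C V\<close>.\<close>

lemma transcript_sim:
  assumes X: "big X C V \<in> matrices k l" and c: "c \<in> set_pmf (coord_coins P)"
    and r: "\<And>i. i < k \<Longrightarrow> r i \<in> set_pmf (proc_coins P i)"
    and C: "C = decode_pmf (zeta_columns k l) d" and V: "\<And>i. i < k \<Longrightarrow> V i = decode_pmf (bits l) (v i)"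
    and r': "\<And>i. i < k \<Longrightarrow> r' i = prod_encode (r i, v i)"
  shows "transcript sim X (prod_encode (c, d)) r' = prelude C @ transcript P (big X C V) c r"
proof -
  have "history_upto sim X (prod_encode (c, d)) r' (k + n) = prelude C @ history_upto P (big X C V) c r n"
    if "n \<le> max_rounds P" for n
    using that
  proof (induction n)
    case 0
    then show ?case
      by (simp add: history_sim_prelude C prelude_def)
  next
    case (Suc n)
    let ?h = "history_upto P (big X C V) c r n"
    have IH: "history_upto sim X (prod_encode (c, d)) r' (k + n) = prelude C @ ?h"
      using Suc by simp
    show ?case
    proof (cases "coord_act P c ?h")
      case (Halt b)
      then show ?thesis
        using IH by (simp add: Let_def sim_def)
    next
      case (Send i m)
      \<comment> \<open>This round belongs to the full transcript of \<open>P\<close>, where only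
        processors below \<open>k\<close> are addressed. So the view of \<open>i\<close> does begin
        with a hint.\<close>
      have "set (history_upto P (big X C V) c r (Suc n)) \<subseteq> set (transcript P (big X C V) c r)"
        using history_upto_mono[of P "big X C V" c r "Suc n" "max_rounds P - Suc n"] Suc.prems
        by (simp add: transcript_def)
      moreover have "i \<in> fst ` set (history_upto P (big X C V) c r (Suc n))"
        using Send by (simp add: Let_def)
      moreover have "\<forall>e\<in>set (transcript P (big X C V) c r). fst e < k"
        using P X c r unfolding is_protocol_def by fastforce
      ultimately have i: "i < k"
        by blast
      have "dec (enc (hint i C)) = hint i C"
        using i by (intro dec_enc hint_in_hints) (auto simp: C decode_pmf_in_set)
      then have "proc_reply sim i (X i) (r' i) (view i (prelude C @ ?h)) m
          = proc_reply P i (big X C V i) (r i) (view i ?h) m"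
        using i row_hint[OF i, of X C V] by (simp add: view_prelude sim_def r' V)
      moreover have "coord_act sim (prod_encode (c, d)) (prelude C @ ?h) = Send i m"
        using Send by (simp add: sim_def)
      ultimately show ?thesis
        using IH Send by (simp add: Let_def)
    qed
  qed
  from this[of "max_rounds P"] show ?thesis
    by (simp add: transcript_def sim_def)
qed

lemma coord_act_sim:
  "coord_act sim (prod_encode (c, d)) (prelude C @ h) = coord_act P c h"
  by (simp add: sim_def)

section \<open>Correctness of the simulation\<close>

lemma big_in_matrices:
  assumes "X \<in> matrices k 2" "C \<in> set_pmf (zeta_columns k l)"
  shows "big X C V \<in> matrices k l"
proof -
  have "i < k \<and> j < l" if b: "big X C V i j" for i j
  proof -
    have "j < l \<longrightarrow> (\<forall>i. snd (snd (C j)) i \<longrightarrow> i < k)" "\<not> j < l \<longrightarrow> C j = default_column"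
      using set_zeta_columnsD[OF assms(2), of j] set_zeta_columnD[of "C j" k] k by auto
    then show ?thesis
      using b assms(1) s t A by (auto simp: big_def column_bits_def matrices_def split: if_splits)
  qed
  then show ?thesis
    by (auto simp: matrices_def)
qed

text \<open>Every column sampled from \<open>zeta_column\<close> contains a zero, so it does not affect disjointness.\<close>
lemma Disj_big:
  assumes "C \<in> set_pmf (zeta_columns k l)"
  shows "Disj k l (big X C V) = Disj k 2 X"
proof -
  \<comment> \<open>The witness is processor \<open>Z\<close> of column \<open>j\<close>, whose
    entry is zero even after redrawing.\<close>
  have no: "\<exists>i<k. \<not> big X C V i j" if "j < l" "j \<noteq> s" "j \<noteq> t" for j
    using set_zeta_columnD[OF set_zeta_columnsD(1)[OF assms that(1)] k] that
    by (intro exI[of _ "fst (snd (C j))"]) (auto simp: big_def column_bits_def)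
  have "Disj k l (big X C V) \<longleftrightarrow> (\<forall>i<k. big X C V i s) \<or> (\<forall>i<k. big X C V i t)"
    using no s t unfolding Disj_def by blast
  also have "\<dots> \<longleftrightarrow> Disj k 2 X"
    using s_t unfolding Disj_def by (auto simp: big_def less_2_cases_iff)
  finally show ?thesis .
qed

lemma is_protocol_sim: "is_protocol k 2 sim"
proof -
  obtain B where B: "\<And>X c r. X \<in> matrices k l \<Longrightarrow> c \<in> set_pmf (coord_coins P) \<Longrightarrow>
      (\<And>i. i < k \<Longrightarrow> r i \<in> set_pmf (proc_coins P i)) \<Longrightarrow>
      (\<exists>b. coord_act P c (transcript P X c r) = Halt b) \<and>
      (\<forall>(i, m, m') \<in> set (transcript P X c r). i < k \<and> length m \<le> B \<and> length m' \<le> B)"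
    using P unfolding is_protocol_def by blast
  obtain B' where B': "\<And>D. D \<in> hints \<Longrightarrow> length (enc D) \<le> B'"
    using finite_hints that[of "Max ((\<lambda>D. length (enc D)) ` hints)"] by simp
  show ?thesis
    unfolding is_protocol_def
  proof (intro exI[of _ "max B B'"] ballI allI impI)
    fix X c' r'
    assume X: "X \<in> matrices k 2" and c': "c' \<in> set_pmf (coord_coins sim)"
      and r': "\<forall>i<k. r' i \<in> set_pmf (proc_coins sim i)"
    obtain c d where c: "c' = prod_encode (c, d)" "c \<in> set_pmf (coord_coins P)"
      using c' by (auto simp: sim_def)
    define C where "C = decode_pmf (zeta_columns k l) d"
    have C: "C \<in> set_pmf (zeta_columns k l)"
      by (simp add: C_def decode_pmf_in_set)
    define r where "r i = fst (prod_decode (r' i))" for i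
    define v where "v i = snd (prod_decode (r' i))" for i
    define V where "V i = decode_pmf (bits l) (v i)" for i
    have r: "r i \<in> set_pmf (proc_coins P i)" if "i < k" for i
      using r' that by (auto simp: r_def sim_def)
    have tr: "transcript sim X c' r' = prelude C @ transcript P (big X C V) c r"
      unfolding c(1)
      by (rule transcript_sim[OF big_in_matrices[OF X C] c(2) r C_def V_def]) (simp_all add: r_def v_def)
    have B1: "(\<exists>b. coord_act P c (transcript P (big X C V) c r) = Halt b) \<and>
      (\<forall>(i, m, m') \<in> set (transcript P (big X C V) c r). i < k \<and> length m \<le> B \<and> length m' \<le> B)"
      by (intro B big_in_matrices X C c r)
    show "(\<exists>b. coord_act sim c' (transcript sim X c' r') = Halt b) \<and>
       (\<forall>(i, m, m')\<in>set (transcript sim X c' r'). i < k \<and> length m \<le> max B B' \<and> length m' \<le> max B B')"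
    proof
      show "\<exists>b. coord_act sim c' (transcript sim X c' r') = Halt b"
        unfolding tr unfolding c(1) coord_act_sim by (rule conjunct1[OF B1])
      have "i < k \<and> length m \<le> max B B' \<and> length m' \<le> max B B'"
        if "(i, m, m') \<in> set (prelude C @ transcript P (big X C V) c r)" for i m m'
      proof (cases "(i, m, m') \<in> set (prelude C)")
        case True
        then show ?thesis
          using B'[OF hint_in_hints[OF _ C]] by (auto simp: prelude_def le_max_iff_disj)
      next
        case False
        then have "(i, m, m') \<in> set (transcript P (big X C V) c r)"
          using that by simp
        from bspec[OF conjunct2[OF B1] this] show ?thesis
          by (simp add: le_max_iff_disj)
      qed
      then show "\<forall>(i, m, m')\<in>set (transcript sim X c' r'). i < k \<and> length m \<le> max B B' \<and> length m' \<le> max B B'"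
        unfolding tr by (intro ballI) (simp only: split_paired_all prod.case)
    qed
  qed
qed

text \<open>For fixed coins the transcript is known; it remains to decode the samples and to reorder
  independent draws.\<close>

lemma run_sim:
  assumes X: "X \<in> matrices k 2"
  shows "run k sim X = do {C \<leftarrow> zeta_columns k l; V \<leftarrow> Pi_pmf {..<k} (\<lambda>_. False) (\<lambda>_. bits l);
    map_pmf (\<lambda>(h, a). (prelude C @ h, a)) (run k P (big X C V))}"
proof -
  \<comment> \<open>Outside \<open>{..<k}\<close> the product distribution has the constant
    \<open>False\<close> vector, while \<open>decode_pmf\<close> of the default coin 0 may be
    another one.\<close>
  let ?dC = "decode_pmf (zeta_columns k l)" and ?dV = "\<lambda>v i. if i < k then decode_pmf (bits l) (v i) else (\<lambda>_. False)"
  let ?cv = "Pi_pmf {..<k} 0 (\<lambda>_. code_pmf (bits l))"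
  let ?cr = "Pi_pmf {..<k} 0 (proc_coins P)"
  have proc: "Pi_pmf {..<k} 0 (proc_coins sim) = map_pmf (\<lambda>(r, v) i. prod_encode (r i, v i)) (pair_pmf ?cr ?cv)"
  proof -
    have "Pi_pmf {..<k} 0 (proc_coins sim) = map_pmf (\<lambda>h. prod_encode \<circ> h)
       (Pi_pmf {..<k} (0, 0) (\<lambda>i. pair_pmf (proc_coins P i) (code_pmf (bits l))))"
      unfolding sim_def by (simp, subst Pi_pmf_map[where dflt="(0, 0)"]) (auto simp: prod_encode_def)
    also have "\<dots> = map_pmf (\<lambda>(r, v) i. prod_encode (r i, v i)) (pair_pmf ?cr ?cv)"
      by (simp add: Pi_pmf_pair pmf.map_comp o_def case_prod_unfold)
    finally show ?thesis .
  qed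
  have V: "Pi_pmf {..<k} (\<lambda>_. False) (\<lambda>_. bits l) = map_pmf ?dV ?cv"
  proof -
    have "Pi_pmf {..<k} (\<lambda>_. False) (\<lambda>_. bits l) = Pi_pmf {..<k} (\<lambda>_. False)
       (\<lambda>i. map_pmf (\<lambda>v. if i < k then decode_pmf (bits l) v else (\<lambda>_. False)) (code_pmf (bits l)))"
      by (intro Pi_pmf_cong) (auto simp: map_decode_pmf)
    also have "\<dots> = map_pmf ?dV ?cv"
      by (rule Pi_pmf_map_dep) auto
    finally show ?thesis .
  qed
  let ?out = "\<lambda>P X c r. (transcript P X c r, coord_act P c (transcript P X c r))"
  have "run k sim X = do {c \<leftarrow> coord_coins P; d \<leftarrow> code_pmf (zeta_columns k l); r \<leftarrow> ?cr; v \<leftarrow> ?cv;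
      return_pmf (?out sim X (prod_encode (c, d)) (\<lambda>i. prod_encode (r i, v i)))}"
    unfolding run_def proc
    by (simp add: sim_def Let_def pair_pmf_def map_pmf_def bind_assoc_pmf bind_return_pmf)
  also have "\<dots> = do {c \<leftarrow> coord_coins P; d \<leftarrow> code_pmf (zeta_columns k l); r \<leftarrow> ?cr; v \<leftarrow> ?cv;
      return_pmf ((\<lambda>(h, a). (prelude (?dC d) @ h, a)) (?out P (big X (?dC d) (?dV v)) c r))}"
  proof (intro bind_pmf_cong refl arg_cong[where f=return_pmf])
    fix c d r v assume *: "c \<in> set_pmf (coord_coins P)" "r \<in> set_pmf ?cr"
    have r: "r i \<in> set_pmf (proc_coins P i)" if "i < k" for i
      using *(2) that by (auto simp: set_Pi_pmf PiE_dflt_def)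
    have "transcript sim X (prod_encode (c, d)) (\<lambda>i. prod_encode (r i, v i))
       = prelude (?dC d) @ transcript P (big X (?dC d) (?dV v)) c r"
      by (rule transcript_sim) (auto simp: * r big_in_matrices X decode_pmf_in_set)
    then show "?out sim X (prod_encode (c, d)) (\<lambda>i. prod_encode (r i, v i))
       = (\<lambda>(h, a). (prelude (?dC d) @ h, a)) (?out P (big X (?dC d) (?dV v)) c r)"
      by (simp add: coord_act_sim)
  qed
  also have "\<dots> = do {d \<leftarrow> code_pmf (zeta_columns k l); v \<leftarrow> ?cv; c \<leftarrow> coord_coins P; r \<leftarrow> ?cr;
      return_pmf ((\<lambda>(h, a). (prelude (?dC d) @ h, a)) (?out P (big X (?dC d) (?dV v)) c r))}"
    by (simp only: bind_commute_pmf[of ?cr ?cv] bind_commute_pmf[of "coord_coins P" ?cv]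
      bind_commute_pmf[of "coord_coins P" "code_pmf (zeta_columns k l)"])
  also have "\<dots> = do {C \<leftarrow> map_pmf ?dC (code_pmf (zeta_columns k l)); V \<leftarrow> map_pmf ?dV ?cv;
    map_pmf (\<lambda>(h, a). (prelude C @ h, a)) (run k P (big X C V))}"
    by (simp add: run_def map_pmf_def bind_assoc_pmf bind_return_pmf Let_def)
  finally show ?thesis
    unfolding map_decode_pmf V .
qed

text \<open>For every fixed sample \<open>P\<close> errs with probability at most
  \<open>\<delta>\<close> on a matrix with the same value of \<open>Disj\<close>; averaging over the
  samples keeps the bound.\<close>

lemma sim_delta_error:
  assumes "P \<in> delta_error_protocols \<delta> k l (Disj k l)"
  shows "sim \<in> delta_error_protocols \<delta> k 2 (Disj k 2)"
proof -
  have "1 - \<delta> \<le> measure_pmf.prob (run k sim X) {(h, a). a = Halt (Disj k 2 X)}" if X: "X \<in> matrices k 2" for X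
  proof -
    let ?E = "{(h, a). a = Halt (Disj k 2 X)} :: (history \<times> action) set"
    let ?R = "do {C \<leftarrow> zeta_columns k l; V \<leftarrow> Pi_pmf {..<k} (\<lambda>_. False) (\<lambda>_. bits l); return_pmf (C, V)}"
    let ?q = "\<lambda>(C, V). map_pmf (\<lambda>(h, a). (prelude C @ h, a)) (run k P (big X C V))"
    have run: "run k sim X = bind_pmf ?R ?q"
      by (simp add: run_sim X bind_assoc_pmf bind_return_pmf)
    have "1 - \<delta> \<le> measure_pmf.prob (?q y) ?E" if "y \<in> set_pmf ?R" for y
    proof -
      obtain C V where y: "y = (C, V)" by force
      then have C: "C \<in> set_pmf (zeta_columns k l)"
        using that by auto
      have "1 - \<delta> \<le> measure_pmf.prob (run k P (big X C V)) {(h, a). a = Halt (Disj k l (big X C V))}"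
        using assms big_in_matrices[OF X C] by (auto simp: delta_error_protocols_def)
      also have "\<dots> = measure_pmf.prob (?q y) ?E"
        by (simp add: y vimage_def Disj_big[OF C] case_prod_unfold)
      finally show ?thesis .
    qed
    then show ?thesis
      unfolding run by (rule prob_bind_pmf_ge)
  qed
  then show ?thesis
    using is_protocol_sim by (simp add: delta_error_protocols_def)
qed

section \<open>Cost of the simulation\<close>

definition two :: "column_data \<Rightarrow> column_data" where
  "two D j = (if j = 0 then D s else if j = 1 then D t else default_column)"

text \<open>The input columns, the sampled columns and the private redraws in \<open>A\<close>
  together form an i.i.d. family of \<open>l\<close> columns. So the simulation is \<open>P\<close>
  on its own input distribution, with column \<open>s\<close> or \<open>t\<close> planted and the
  prelude added to the history.\<close>

lemma slice_sim:
  assumes w: "w < 2"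
  shows "slice k 2 sim w = map_pmf (\<lambda>y. (two (fst y), prelude (fst y) @ snd y)) (slice k l P (if w = 0 then s else t))"
proof -
  let ?e = "if w = 0 then s else t"
  let ?V = "Pi_pmf {..<k} (\<lambda>_. False) (\<lambda>_. bits l)"
  let ?R = "\<lambda>C V j. if j \<in> A then resample k (C j) (\<lambda>i. V i j) else C j"
  let ?E = "\<lambda>C' C j. if j = s then C' 0 else if j = t then C' 1 else C j"
  let ?f = "\<lambda>D. map_pmf (\<lambda>(h, a). (two D, prelude D @ h)) (run k P (planted k ?e D))"
  have "slice k 2 sim w = do {C' \<leftarrow> zeta_columns k 2; C \<leftarrow> zeta_columns k l; V \<leftarrow> ?V;
     map_pmf (\<lambda>(h, a). (C', prelude C @ h)) (run k P (big (planted k w C') C V))}"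
    unfolding slice_def
    by (intro bind_pmf_cong refl)
       (simp add: run_sim planted_in_matrices w k bind_assoc_pmf bind_map_pmf map_pmf_def bind_return_pmf case_prod_unfold)
  also have "\<dots> = do {C' \<leftarrow> zeta_columns k 2; C \<leftarrow> zeta_columns k l; V \<leftarrow> ?V; ?f (?E C' (?R C V))}"
  proof (intro bind_pmf_cong refl)
    fix C' C V assume C': "C' \<in> set_pmf (zeta_columns k 2)"
    let ?D = "?E C' (?R C V)"
    have "big (planted k w C') C V = planted k ?e ?D"
      using s_t w A by (auto simp: big_def planted_def fun_eq_iff)
    moreover have "two ?D = C'"
      using s_t set_zeta_columnsD(2)[OF C'] by (auto simp: two_def fun_eq_iff)
    \<comment> \<open>Hints mask columns \<open>s\<close> and \<open>t\<close> and the row entries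
      in \<open>A\<close>, which are all that distinguishes \<open>?D\<close> from
      \<open>C\<close>.\<close>
    moreover have "prelude ?D = prelude C"
      using s_t by (auto simp: prelude_def hint_def[abs_def] fun_eq_iff intro!: arg_cong[where f=enc])
    ultimately show "map_pmf (\<lambda>(h, a). (C', prelude C @ h)) (run k P (big (planted k w C') C V)) = ?f ?D"
      by simp
  qed
  also have "\<dots> = do {C' \<leftarrow> zeta_columns k 2; C \<leftarrow> map_pmf (\<lambda>(C, V). ?R C V) (pair_pmf (zeta_columns k l) ?V); ?f (?E C' C)}"
    by (simp add: pair_pmf_def map_pmf_def bind_assoc_pmf bind_return_pmf)
  also have "\<dots> = do {C' \<leftarrow> zeta_columns k 2; C \<leftarrow> zeta_columns k l; ?f (?E C' C)}"
    unfolding resample_zeta_columns ..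
  also have "\<dots> = do {D \<leftarrow> map_pmf (\<lambda>(C', C). ?E C' C) (pair_pmf (zeta_columns k 2) (zeta_columns k l)); ?f D}"
    by (simp add: pair_pmf_def map_pmf_def bind_assoc_pmf bind_return_pmf)
  also have "\<dots> = do {D \<leftarrow> zeta_columns k l; ?f D}"
    unfolding Pi_pmf_embed_two[OF s t s_t] ..
  also have "\<dots> = map_pmf (\<lambda>y. (two (fst y), prelude (fst y) @ snd y)) (slice k l P ?e)"
    by (simp add: slice_def map_bind_pmf case_prod_unfold map_pmf_def bind_assoc_pmf bind_return_pmf)
  finally show ?thesis .
qed

lemma slice_indep:
  assumes F: "\<And>C D. C s = D s \<Longrightarrow> C t = D t \<Longrightarrow> F C = F D"
    and G: "\<And>C D. (\<And>j. j \<noteq> s \<Longrightarrow> j \<noteq> t \<Longrightarrow> C j = D j) \<Longrightarrow> G C = G D"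
  shows "map_pmf (\<lambda>y. (F (fst y), G (fst y))) (slice k l P w)
    = pair_pmf (map_pmf (\<lambda>y. F (fst y)) (slice k l P w)) (map_pmf (\<lambda>y. G (fst y)) (slice k l P w))"
proof -
  have *: "map_pmf (\<lambda>y. H (fst y)) (slice k l P w) = map_pmf H (zeta_columns k l)" for H :: "column_data \<Rightarrow> 'e"
    unfolding map_fst_slice[of k l P w, symmetric] by (simp add: pmf.map_comp o_def)
  show ?thesis
    unfolding *[of F] *[of G] *[of "\<lambda>C. (F C, G C)"]
  proof (rule Pi_pmf_indep[where K="{s, t}"])
    show "F f = F g" if "\<And>x. x \<in> {s, t} \<Longrightarrow> f x = g x" for f g
      by (rule F) (use that in auto)
    show "G f = G g" if "\<And>x. x \<notin> {s, t} \<Longrightarrow> f x = g x" for f g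
      by (rule G) (use that in auto)
  qed (use s t in auto)
qed

text \<open>The view in the simulation is the hint followed by the view in \<open>P\<close>. The
  hint is a function of data on the other columns, so \<open>cmi_le_of_indep\<close> moves that data
  into the condition, which then has the fibres used in \<open>share\<close>.\<close>

lemma cost_sim_le:
  assumes w: "w < 2" and i: "i < k"
  shows "cost k 2 sim w i \<le> share k l P i (if w = 0 then s else t) (if w = 0 then t else s) A"
proof -
  define e o' where "e = (if w = 0 then s else t)" and "o' = (if w = 0 then t else s)"
  let ?Q = "slice k l P e"
  have eo: "e \<noteq> o'" "{e, o'} = {s, t}" "e < l" "o' < l"
    using s_t s t by (auto simp: e_def o'_def)
  have fin: "finite (set_pmf ?Q)"
    by (rule finite_set_slice[OF P k eo(3)])
  have supp: "fst y \<in> set_pmf (zeta_columns k l)" if "y \<in> set_pmf ?Q" for y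
    using that map_fst_slice[of k l P e] by (metis imageI set_map_pmf)
  have enc_iff: "enc (hint i (fst x)) = enc (hint i (fst y)) \<longleftrightarrow> hint i (fst x) = hint i (fst y)"
    if "x \<in> set_pmf ?Q" "y \<in> set_pmf ?Q" for x y
    using that supp hint_in_hints[OF i] dec_enc by metis
  have drop_iff: "drop_coord 2 w f = drop_coord 2 w g \<longleftrightarrow> f (Suc 0 - w) = g (Suc 0 - w)" for f g :: "nat \<Rightarrow> 'e"
    using w by (auto simp: drop_coord_def fun_eq_iff restrict_def less_2_cases_iff)
  have two_o: "two D (Suc 0 - w) = D o'" for D
    using w by (auto simp: two_def o'_def less_2_cases_iff)
  have planted_o: "planted k w (two D) i (Suc 0 - w) = snd (snd (D o')) i" for D
    using w by (auto simp: two_def o'_def planted_def less_2_cases_iff)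
  have two_iff: "(\<forall>j. f (two C j) = f (two D j)) \<longleftrightarrow> f (C s) = f (D s) \<and> f (C t) = f (D t)" for f :: "_ \<Rightarrow> 'e" and C D
    by (auto simp: two_def)
  have planted_iff: "planted k w (two C) i = planted k w (two D) i \<longleftrightarrow> snd (snd (C o')) i = snd (snd (D o')) i" for C D
    using w by (auto simp: two_def planted_def fun_eq_iff o'_def)
  have view_iff: "view i (prelude (fst x) @ snd x) = view i (prelude (fst y) @ snd y)
     \<longleftrightarrow> hint i (fst x) = hint i (fst y) \<and> view i (snd x) = view i (snd y)"
    if "x \<in> set_pmf ?Q" "y \<in> set_pmf ?Q" for x y
    using enc_iff[OF that] by (simp add: view_prelude[OF i])
  have split_all: "(\<forall>j. Q j) \<longleftrightarrow> Q s \<and> Q t \<and> (\<forall>j. j \<noteq> s \<and> j \<noteq> t \<longrightarrow> Q j)" for Q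
    by metis
  \<comment> \<open>\<open>S1\<close> and \<open>S2\<close> collect what the conditions of the two
    terms of \<open>share\<close> contain about columns other than \<open>s\<close> and
    \<open>t\<close>: \<open>Z\<close> with \<open>M\<close> on \<open>A\<close> and the whole row,
    respectively \<open>Z\<close> with all of \<open>M\<close> and the row outside
    \<open>A\<close>.\<close>
  define S1 where "S1 C j = (if j = s \<or> j = t then (False, 0, False) else
    (j \<in> A \<and> fst (C j), fst (snd (C j)), snd (snd (C j)) i))" for C :: column_data and j
  define S2 where "S2 C j = (if j = s \<or> j = t then (False, 0, False) else
    (fst (C j), fst (snd (C j)), j \<notin> A \<and> snd (snd (C j)) i))" for C :: column_data and j
  \<comment> \<open>\<open>g1\<close> forgets the row entries in \<open>A\<close>, \<open>g2\<close>
    forgets \<open>M\<close> outside \<open>A\<close>; both leave exactly the hint.\<close>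
  define g1 :: "(nat \<Rightarrow> bool \<times> nat \<times> bool) \<Rightarrow> nat \<Rightarrow> bool \<times> nat \<times> bool"
    where "g1 f j = (fst (f j), fst (snd (f j)), j \<notin> A \<and> snd (snd (f j)))" for f j
  define g2 :: "(nat \<Rightarrow> bool \<times> nat \<times> bool) \<Rightarrow> nat \<Rightarrow> bool \<times> nat \<times> bool"
    where "g2 f j = (j \<in> A \<and> fst (f j), fst (snd (f j)), snd (snd (f j)))" for f j
  have g1: "hint i C = g1 (S1 C)" for C
    by (auto simp: hint_def g1_def S1_def fun_eq_iff)
  have g2: "hint i C = g2 (S2 C)" for C
    by (auto simp: hint_def g2_def S2_def fun_eq_iff)
  \<comment> \<open>The planted entry is constant, so \<open>?C1\<close> keeps only the row entry at
    \<open>o'\<close>. \<open>M\<close> and \<open>Z\<close> are recorded before planting, so they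
    appear for both columns.\<close>
  let ?C1 = "\<lambda>y :: column_data \<times> history. (snd (snd (fst y o')) i, Zof y s, Zof y t)"
  let ?C2 = "\<lambda>y :: column_data \<times> history. (Mof y s, Mof y t, Zof y s, Zof y t)"
  let ?V = "\<lambda>y :: column_data \<times> history. view i (snd y)"
  have "cost k 2 sim w i =
      cmi ?Q (\<lambda>y. drop_coord 2 w (\<lambda>j. fst (two (fst y) j))) (\<lambda>y. view i (prelude (fst y) @ snd y))
        (\<lambda>y. (planted k w (two (fst y)) i, \<lambda>j. fst (snd (two (fst y) j))))
    + cmi ?Q (\<lambda>y. drop_coord 2 w (planted k w (two (fst y)) i)) (\<lambda>y. view i (prelude (fst y) @ snd y))
        (\<lambda>y. (\<lambda>j. fst (two (fst y) j), \<lambda>j. fst (snd (two (fst y) j))))"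
    by (simp add: cost_def slice_sim[OF w] cmi_map e_def)
  also have "\<dots> = cmi ?Q (\<lambda>y. Mof y o') (\<lambda>y. (g1 (S1 (fst y)), ?V y)) ?C1
    + cmi ?Q (\<lambda>y. snd (snd (fst y o')) i) (\<lambda>y. (g2 (S2 (fst y)), ?V y)) ?C2"
    unfolding g1[symmetric] g2[symmetric]
    by (intro arg_cong2[where f="(+)"] cmi_cong)
       (simp_all add: drop_iff two_o planted_o planted_iff view_iff fun_eq_iff[of "\<lambda>j. fst (two _ j)"]
         fun_eq_iff[of "\<lambda>j. fst (snd (two _ j))"] two_iff[of fst] two_iff[of "\<lambda>x. fst (snd x)"])
  also have "\<dots> \<le> cmi ?Q (\<lambda>y. Mof y o') ?V (\<lambda>y. (S1 (fst y), ?C1 y))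
     + cmi ?Q (\<lambda>y. snd (snd (fst y o')) i) ?V (\<lambda>y. (S2 (fst y), ?C2 y))"
  proof (intro add_mono cmi_le_of_indep fin)
    show "map_pmf (\<lambda>y. ((Mof y o', ?C1 y), S1 (fst y))) ?Q
      = pair_pmf (map_pmf (\<lambda>y. (Mof y o', ?C1 y)) ?Q) (map_pmf (\<lambda>y. S1 (fst y)) ?Q)"
      by (rule slice_indep[where F="\<lambda>C. (fst (C o'), snd (snd (C o')) i, fst (snd (C s)), fst (snd (C t)))"])
         (auto simp: S1_def fun_eq_iff o'_def)
    show "map_pmf (\<lambda>y. ((snd (snd (fst y o')) i, ?C2 y), S2 (fst y))) ?Q
      = pair_pmf (map_pmf (\<lambda>y. (snd (snd (fst y o')) i, ?C2 y)) ?Q) (map_pmf (\<lambda>y. S2 (fst y)) ?Q)"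
      by (rule slice_indep[where F="\<lambda>C. (snd (snd (C o')) i, fst (C s), fst (C t), fst (snd (C s)), fst (snd (C t)))"])
         (auto simp: S2_def fun_eq_iff o'_def)
  qed
  also have "cmi ?Q (\<lambda>y. Mof y o') ?V (\<lambda>y. (S1 (fst y), ?C1 y))
     = cmi ?Q (\<lambda>y. Mof y o') ?V (\<lambda>y. (restrict (Mof y) A, planted k e (fst y) i, Zof y))"
  proof (rule cmi_cong)
    fix x y :: "column_data \<times> history"
    have S: "S1 (fst x) = S1 (fst y) \<longleftrightarrow> (\<forall>j. j \<noteq> s \<and> j \<noteq> t \<longrightarrow> (j \<in> A \<longrightarrow> Mof x j = Mof y j)
        \<and> Zof x j = Zof y j \<and> snd (snd (fst x j)) i = snd (snd (fst y j)) i)"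
      by (auto simp: S1_def fun_eq_iff)
    have R: "restrict (Mof x) A = restrict (Mof y) A \<longleftrightarrow> (\<forall>j. j \<noteq> s \<and> j \<noteq> t \<longrightarrow> j \<in> A \<longrightarrow> Mof x j = Mof y j)"
      using A by (auto simp: fun_eq_iff restrict_def)
    have X: "planted k e (fst x) i = planted k e (fst y) i \<longleftrightarrow>
      (\<forall>j. j \<noteq> e \<longrightarrow> snd (snd (fst x j)) i = snd (snd (fst y j)) i)"
      by (auto simp: planted_def fun_eq_iff)
    show "((S1 (fst x), ?C1 x) = (S1 (fst y), ?C1 y)) =
      ((restrict (Mof x) A, planted k e (fst x) i, Zof x) = (restrict (Mof y) A, planted k e (fst y) i, Zof y))"
      unfolding prod.inject S R X fun_eq_iff[of "Zof x"]
      using eo(1,2) by (smt (verit) insert_iff singletonD)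
  qed auto
  also have "cmi ?Q (\<lambda>y. snd (snd (fst y o')) i) ?V (\<lambda>y. (S2 (fst y), ?C2 y))
     = cmi ?Q (\<lambda>y. planted k e (fst y) i o') ?V
         (\<lambda>y. (restrict (planted k e (fst y) i) ({..<l} - {e, o'} - A), Mof y, Zof y))"
  proof (rule cmi_cong)
    fix x y :: "column_data \<times> history" assume x: "x \<in> set_pmf ?Q" and y: "y \<in> set_pmf ?Q"
    \<comment> \<open>Beyond \<open>l\<close> all columns are the default one, so restricting the
      row to \<open>{..<l}\<close> loses nothing against \<open>S2\<close>.\<close>
    have out: "fst x j = fst y j" if "\<not> j < l" for j
      using set_zeta_columnsD(2)[OF supp[OF x] that] set_zeta_columnsD(2)[OF supp[OF y] that] by simp
    have S: "S2 (fst x) = S2 (fst y) \<longleftrightarrow> (\<forall>j. j \<noteq> s \<and> j \<noteq> t \<longrightarrow> (j \<notin> A \<longrightarrow> snd (snd (fst x j)) i = snd (snd (fst y j)) i)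
        \<and> Zof x j = Zof y j \<and> Mof x j = Mof y j)"
      by (auto simp: S2_def fun_eq_iff)
    have R: "restrict (planted k e (fst x) i) ({..<l} - {e, o'} - A) = restrict (planted k e (fst y) i) ({..<l} - {e, o'} - A)
       \<longleftrightarrow> (\<forall>j. j \<noteq> s \<and> j \<noteq> t \<longrightarrow> j \<notin> A \<longrightarrow> snd (snd (fst x j)) i = snd (snd (fst y j)) i)"
       (is "?L \<longleftrightarrow> ?R")
    proof -
      have "planted k e C i j = snd (snd (C j)) i" if "j \<noteq> s" "j \<noteq> t" for C j
        using that by (simp add: planted_def e_def)
      moreover have "restrict f S = restrict g S \<longleftrightarrow> (\<forall>j\<in>S. f j = g j)" for f g :: "nat \<Rightarrow> bool" and S
        by (auto simp: fun_eq_iff restrict_def)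
      ultimately have "?L \<longleftrightarrow> (\<forall>j\<in>{..<l} - {s, t} - A. snd (snd (fst x j)) i = snd (snd (fst y j)) i)"
        unfolding eo(2) by simp
      also have "\<dots> \<longleftrightarrow> ?R"
      proof (rule iffI, intro allI impI)
        fix j assume "\<forall>j\<in>{..<l} - {s, t} - A. snd (snd (fst x j)) i = snd (snd (fst y j)) i" "j \<noteq> s \<and> j \<noteq> t" "j \<notin> A"
        then show "snd (snd (fst x j)) i = snd (snd (fst y j)) i"
          using out[of j] by (cases "j < l") simp_all
      qed simp
      finally show ?thesis .
    qed
    show "((S2 (fst x), ?C2 x) = (S2 (fst y), ?C2 y)) =
      ((restrict (planted k e (fst x) i) ({..<l} - {e, o'} - A), Mof x, Zof x)
       = (restrict (planted k e (fst y) i) ({..<l} - {e, o'} - A), Mof y, Zof y))"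
      unfolding prod.inject S R fun_eq_iff[of "Zof x"] fun_eq_iff[of "Mof x"]
        split_all[of "\<lambda>j. Mof x j = Mof y j"] split_all[of "\<lambda>j. Zof x j = Zof y j"]
      by blast
  qed (use eo(1) in \<open>auto simp: planted_def\<close>)
  finally show ?thesis
    unfolding share_def e_def[symmetric] o'_def[symmetric] .
qed

lemma PIC_sim_le:
  "PIC k 2 sim \<le> ((\<Sum>i<k. share k l P i s t A) + (\<Sum>i<k. share k l P i t s A)) / 2"
proof -
  have "sum f {..<2::nat} = f 0 + f 1" for f :: "nat \<Rightarrow> real"
    by (simp add: numeral_2_eq_2)
  then have "PIC k 2 sim = ((\<Sum>i<k. cost k 2 sim 0 i) + (\<Sum>i<k. cost k 2 sim 1 i)) / 2"
    by (simp add: PIC_eq[OF is_protocol_sim k])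
  also have "\<dots> \<le> ((\<Sum>i<k. share k l P i s t A) + (\<Sum>i<k. share k l P i t s A)) / 2"
    using cost_sim_le[of 0] cost_sim_le[of 1] by (intro divide_right_mono add_mono sum_mono) auto
  finally show ?thesis .
qed

end

section \<open>Averaging over pairs of columns\<close>

text \<open>The distance from \<open>s\<close> up to \<open>j\<close> on the cycle of
  \<open>l\<close> columns, that is \<open>(j - s) mod l\<close> for indices below
  \<open>l\<close>.\<close>

definition cyc_pos :: "nat \<Rightarrow> nat \<Rightarrow> nat \<Rightarrow> int" where
  "cyc_pos l s j = (if s \<le> j then int j - int s else int j - int s + int l)"

definition cyc_arc :: "nat \<Rightarrow> nat \<Rightarrow> nat \<Rightarrow> nat set" where
  "cyc_arc l s t = {j\<in>{..<l} - {s}. cyc_pos l s j < cyc_pos l s t}"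

lemma inj_on_cyc_pos: "s < l \<Longrightarrow> inj_on (cyc_pos l s) {..<l}"
  by (auto simp: inj_on_def cyc_pos_def split: if_splits)

text \<open>Walking upwards from \<open>t\<close> around the cycle, one meets \<open>s\<close> first
  and then the columns strictly between \<open>s\<close> and \<open>t\<close>. These are therefore
  the ones farther from \<open>t\<close> than \<open>s\<close> is.\<close>

lemma cyc_arc_backwards:
  assumes "s < l" "t < l" "s \<noteq> t"
  shows "cyc_arc l s t = {j\<in>{..<l} - {t}. - cyc_pos l t j < - cyc_pos l t s}"
  using assms by (auto simp: cyc_arc_def cyc_pos_def split: if_splits)

lemma sum_PIC_sim_le:
  assumes P: "is_protocol k l P" and k: "k > 0" and l: "l > 0"
  shows "(\<Sum>s<l. \<Sum>t\<in>{..<l} - {s}. PIC k 2 (embedding.sim k l s t (cyc_arc l s t) P)) \<le> real l * PIC k l P"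
proof -
  let ?f = "\<lambda>s t. \<Sum>i<k. share k l P i s t (cyc_arc l s t)" and ?b = "\<lambda>s t. \<Sum>i<k. share k l P i t s (cyc_arc l s t)"
  let ?c = "\<Sum>w<l. \<Sum>i<k. cost k l P w i"
  have "(\<Sum>s<l. \<Sum>t\<in>{..<l} - {s}. PIC k 2 (embedding.sim k l s t (cyc_arc l s t) P))
      \<le> (\<Sum>s<l. \<Sum>t\<in>{..<l} - {s}. (?f s t + ?b s t) / 2)"
  proof (intro sum_mono)
    fix s t assume "s \<in> {..<l}" "t \<in> {..<l} - {s}"
    then interpret embedding k l s t "cyc_arc l s t" P
      using k P by unfold_locales (auto simp: cyc_arc_def)
    show "PIC k 2 sim \<le> (?f s t + ?b s t) / 2"
      by (rule PIC_sim_le)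
  qed
  also have "\<dots> = ((\<Sum>s<l. \<Sum>t\<in>{..<l} - {s}. ?f s t) + (\<Sum>s<l. \<Sum>t\<in>{..<l} - {s}. ?b s t)) / 2"
    by (simp add: sum.distrib flip: sum_divide_distrib)
  \<comment> \<open>With \<open>s\<close> planted, the arcs are the initial segments of the cyclic
    order starting at \<open>s\<close>.\<close>
  also have "(\<Sum>s<l. \<Sum>t\<in>{..<l} - {s}. ?f s t) = ?c"
  proof (rule sum.cong[OF refl])
    fix s assume "s \<in> {..<l}"
    then have "inj_on (cyc_pos l s) ({..<l} - {s})"
      using inj_on_cyc_pos[of s l] by (auto intro: inj_on_subset)
    then show "(\<Sum>t\<in>{..<l} - {s}. ?f s t) = (\<Sum>i<k. cost k l P s i)"
      unfolding cyc_arc_def by (subst sum.swap) (simp only: sum_share)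
  qed
  also have "(\<Sum>s<l. \<Sum>t\<in>{..<l} - {s}. ?b s t) = (\<Sum>t<l. \<Sum>s\<in>{..<l} - {t}. ?b s t)"
    using sum.swap_restrict[of "{..<l}" "{..<l}" "\<lambda>s t. ?b s t" "\<lambda>s t. s \<noteq> t"]
    by (simp add: set_diff_eq eq_commute)
  \<comment> \<open>With \<open>t\<close> planted, the same arcs are initial segments of the
    reversed cyclic order starting at \<open>t\<close>.\<close>
  also have "\<dots> = ?c"
  proof (rule sum.cong[OF refl])
    fix t assume t: "t \<in> {..<l}"
    then have "inj_on (\<lambda>j. - cyc_pos l t j) ({..<l} - {t})"
      using inj_on_cyc_pos[of t l] by (auto simp: inj_on_def)
    then have "(\<Sum>s\<in>{..<l} - {t}. \<Sum>i<k. share k l P i t s {j\<in>{..<l} - {t}. - cyc_pos l t j < - cyc_pos l t s}) = (\<Sum>i<k. cost k l P t i)"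
      by (subst sum.swap) (simp only: sum_share)
    moreover have "(\<Sum>s\<in>{..<l} - {t}. ?b s t)
      = (\<Sum>s\<in>{..<l} - {t}. \<Sum>i<k. share k l P i t s {j\<in>{..<l} - {t}. - cyc_pos l t j < - cyc_pos l t s})"
      using t by (intro sum.cong refl arg_cong[where f="share k l P _ t _"] cyc_arc_backwards) auto
    ultimately show "(\<Sum>s\<in>{..<l} - {t}. ?b s t) = (\<Sum>i<k. cost k l P t i)"
      by simp
  qed
  finally show ?thesis
    using l by (simp add: PIC_eq[OF P k l])
qed

theorem theorem3:
  fixes k l :: nat and \<delta> :: real
  assumes "k \<ge> 2" and "l \<ge> 1" and "0 \<le> \<delta>" and "\<delta> < 1"
  shows "PIC_inf \<delta> k l (Disj k l) \<ge> ereal (real l - 1) * PIC_inf \<delta> k 2 (Disj k 2)"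
  unfolding PIC_inf_def[of \<delta> k l]
proof (rule INF_greatest)
  fix P assume err: "P \<in> delta_error_protocols \<delta> k l (Disj k l)"
  have k: "k > 0" and l: "l > 0"
    using assms by auto
  have prot: "is_protocol k l P"
    using err by (simp add: delta_error_protocols_def)
  show "ereal (real l - 1) * PIC_inf \<delta> k 2 (Disj k 2) \<le> ereal (PIC k l P)"
  \<comment> \<open>For one column there is no pair to embed into, but the left-hand side is zero
    and the cost is nonnegative.\<close>
  proof (cases "l = 1")
    case True
    then show ?thesis
      using PIC_nonneg[OF prot k l] by (simp flip: zero_ereal_def)
  next
    case False
    have sim: "PIC_inf \<delta> k 2 (Disj k 2) \<le> ereal (PIC k 2 (embedding.sim k l s t (cyc_arc l s t) P))"
      if "s < l" "t < l" "s \<noteq> t" for s t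
    proof -
      interpret embedding k l s t "cyc_arc l s t" P
        using that k prot by unfold_locales (auto simp: cyc_arc_def)
      show ?thesis
        unfolding PIC_inf_def by (intro INF_lower sim_delta_error err)
    qed
    \<comment> \<open>The infimum is nonnegative and at most the cost of the simulation for columns
      0 and 1. It is thus a real number, and the rest is real arithmetic.\<close>
    have "0 \<le> PIC_inf \<delta> k 2 (Disj k 2)"
      unfolding PIC_inf_def using k by (intro INF_greatest) (auto simp: delta_error_protocols_def intro!: PIC_nonneg)
    moreover have "PIC_inf \<delta> k 2 (Disj k 2) < \<infinity>"
      using sim[of 0 1] False l by (intro le_less_trans[OF sim[of 0 1]]) auto
    ultimately obtain x where x: "PIC_inf \<delta> k 2 (Disj k 2) = ereal x"
      by (cases "PIC_inf \<delta> k 2 (Disj k 2)") auto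
    \<comment> \<open>There are \<open>l * (l - 1)\<close> ordered pairs, and each simulation costs
      at least \<open>x\<close>.\<close>
    have "real l * ((real l - 1) * x) = (\<Sum>s<l. \<Sum>t\<in>{..<l} - {s}. x)"
      using l by (simp add: of_nat_diff)
    also have "\<dots> \<le> (\<Sum>s<l. \<Sum>t\<in>{..<l} - {s}. PIC k 2 (embedding.sim k l s t (cyc_arc l s t) P))"
      using sim by (intro sum_mono) (auto simp: x)
    also have "\<dots> \<le> real l * PIC k l P"
      by (rule sum_PIC_sim_le[OF prot k l])
    finally show ?thesis
      using l by (simp add: x)
  qed
qed

end
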